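(* Let $n\ge1$ and let $\phi:\mathbb{N}\to(0,\infty)$ be a function such that $k\mapsto k\phi(k)$ is non-increasing. Then the Lebesgue measure of $A(\phi,S^n)$ is full (resp. zero) if and only if the sum $$\sum_{k=1}^\infty k^{n-1}\phi(k)^n$$ diverges (resp. converges).
   Context: $S^n\subset\mathbb{R}^{n+1}$ is the Euclidean unit sphere, with its Lebesgue (surface) measure; "full" means that the complement in $S^n$ has measure zero. $\|\cdot\|$ is the supremum norm on $\mathbb{R}^{n+1}$. $A(\phi,S^n)$ is the set of $\alpha\in S^n$ that are $\phi$-approximable in $S^n$, i.e. for which there exist infinitely many $(\mathbf{p},q)\in\mathbb{Z}^{n+1}\times\mathbb{N}$ with $\frac{\mathbf{p}}{q}\in S^n$ and $\left\|\alpha-\frac{\mathbf{p}}{q}\right\|<\phi(q)$. *)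

theory Defs
  imports "HOL-Analysis.Analysis"
begin

(* Surface measure on the unit sphere of a d-dimensional Euclidean space via polar coordinates:
   a Borel subset A of the sphere has d times the volume of the open cone
   {t a | 0 < t < 1, a \<in> A} (see emeasure_sphere_surface below).  The completion makes it
   the Lebesgue measure on the sphere. *)
definition sphere_surface :: "'a::euclidean_space measure" where
  "sphere_surface = completion (scale_measure (of_nat DIM('a))
     (distr (restrict_space lborel (ball 0 1 - {0})) (restrict_space borel (sphere 0 1))
        (\<lambda>x. x /\<^sub>R norm x)))"

definition rat_point :: "int ^ 'd \<Rightarrow> nat \<Rightarrow> real ^ 'd" where
  "rat_point p q = (\<chi> i. real_of_int (p $ i) / real q)"

(* Pairs (p, q) are counted, not the points p/q, and p/q need not be in lowest terms.
   infnorm is the supremum norm of the coordinates. *)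
definition approximable :: "(nat \<Rightarrow> real) \<Rightarrow> (real ^ 'd::finite) set \<Rightarrow> (real ^ 'd) set" where
  "approximable \<phi> S = {\<alpha> \<in> S. infinite {(p, q). q \<ge> 1 \<and> rat_point p q \<in> S
     \<and> infnorm (\<alpha> - rat_point p q) < \<phi> q}}"

lemma measurable_radial_projection:
  "(\<lambda>x. x /\<^sub>R norm x) \<in> measurable (restrict_space lborel (ball 0 1 - {0}))
     (restrict_space borel (sphere 0 1 :: 'a::euclidean_space set))"
proof (rule measurable_restrict_space2)
  show "(\<lambda>x. x /\<^sub>R norm x) \<in> space (restrict_space lborel (ball 0 1 - {0::'a})) \<rightarrow> sphere 0 1"
    by (auto simp: space_restrict_space)
  show "(\<lambda>x::'a. x /\<^sub>R norm x) \<in> borel_measurable (restrict_space lborel (ball 0 1 - {0}))"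
    by (rule measurable_restrict_space1) measurable
qed

lemma space_sphere_surface: "space (sphere_surface :: 'a::euclidean_space measure) = sphere 0 1"
  by (simp add: sphere_surface_def space_scale_measure space_restrict_space)

lemma emeasure_sphere_surface:
  fixes A :: "'a::euclidean_space set"
  assumes "A \<in> sets borel" "A \<subseteq> sphere 0 1"
  shows "emeasure sphere_surface A
    = of_nat DIM('a) * emeasure lborel {t *\<^sub>R a |t a. 0 < t \<and> t < 1 \<and> a \<in> A}"
proof -
  have A: "A \<in> sets (restrict_space borel (sphere 0 1))"
    using assms by (auto simp: sets_restrict_space)
  have eq: "(\<lambda>x. x /\<^sub>R norm x) -` A \<inter> space (restrict_space lborel (ball 0 1 - {0}))
      = {t *\<^sub>R a |t a. 0 < t \<and> t < 1 \<and> a \<in> A}" (is "?L = ?R")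
  proof
    show "?L \<subseteq> ?R"
    proof
      fix x assume x: "x \<in> ?L"
      then have "x = norm x *\<^sub>R (x /\<^sub>R norm x)" "0 < norm x" "norm x < 1" "x /\<^sub>R norm x \<in> A"
        by (auto simp: space_restrict_space)
      then show "x \<in> ?R" by blast
    qed
    show "?R \<subseteq> ?L"
      using assms(2) by (auto simp: space_restrict_space subset_iff)
  qed
  have "emeasure sphere_surface A = of_nat DIM('a) *
      emeasure (distr (restrict_space lborel (ball 0 1 - {0})) (restrict_space borel (sphere 0 1))
        (\<lambda>x. x /\<^sub>R norm x)) A"
    using A by (simp add: sphere_surface_def)
  also have "\<dots> = of_nat DIM('a) * emeasure (restrict_space lborel (ball 0 1 - {0})) ?R"
    by (subst emeasure_distr[OF measurable_radial_projection A]) (simp only: eq)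
  also have "emeasure (restrict_space lborel (ball 0 1 - {0})) ?R = emeasure lborel ?R"
    by (rule emeasure_restrict_space) (use eq in \<open>auto simp: space_restrict_space\<close>)
  finally show ?thesis .
qed

end

theory Submission
  imports Defs
begin

text \<open>
  Two distinct rational points \<open>p/q\<close>, \<open>p'/q'\<close> of the unit sphere have squared distance
  \<open>2 (q q' - p \<bullet> p') / (q q') \<ge> 2 / (q q')\<close>. By a volume comparison the number of rational points with
  denominator at most \<open>T\<close> in a region is therefore at most of the order of \<open>T ^ n\<close> times its area,
  and the convergence half is the Borel--Cantelli lemma.

  For the divergence half, a theorem of Dirichlet type holds on the sphere: for all \<open>T \<ge> 1\<close> every \<open>\<alpha>\<close> has a rational point
  \<open>p/q\<close> with \<open>q \<le> C T\<close> and \<open>dist \<alpha> (p/q) ^ 2 \<le> C / (q T)\<close>. In terms of \<open>(p, q)\<close> this asks for a short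
  isotropic vector in the image of the integer lattice under a Lorentz boost. A non-zero vector of length less than 1 is isotropic, since the
  Lorentz form is integral. If there is none, the lattice has a bounded system of linearly independent vectors;
  only finitely many Gram matrices are possible, and for each of them a fixed integer combination is
  isotropic. Removing the small denominators, which cover little, one obtains that an open set \<open>U\<close> contains at
  least a constant times \<open>T ^ n\<close> times the area of \<open>U\<close> rational points of denominator about \<open>T\<close>. By the
  repulsion of rational points, the small balls around them are independent on average, so the set of approximable
  points fills a fixed proportion of every open set, and hence its complement is null.
\<close>

section \<open>A theorem of Blichfeldt\<close>

text \<open>The unit cells cut \<open>A\<close> into the pieces \<open>X z\<close>, and translation
  by lattice vectors moves all of them into the cell \<open>Q\<close> of volume at most 1. If the
  translates \<open>Y z\<close> were disjoint, \<open>A\<close> would have volume at most 1; so two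
  of them meet, and a common point lifts to two points of \<open>A\<close> with an integral
  difference.\<close>

lemma blichfeldt:
  fixes A :: "(real ^ 'n) set"
  assumes A: "A \<in> sets borel" and gt: "emeasure lborel A > 1"
  obtains x z where "x \<in> A" "x + z \<in> A" "z \<noteq> 0" "\<forall>i. z $ i \<in> \<int>"
proof -
  define v :: "int ^ 'n \<Rightarrow> real ^ 'n" where "v z = (\<chi> i. of_int (z $ i))" for z
  \<comment> \<open>Half-open, so that the integer translates of \<open>Q\<close> partition the
    space.\<close>
  define Q :: "(real ^ 'n) set" where "Q = {x. \<forall>i. 0 \<le> x $ i \<and> x $ i < 1}"
  have Qeq: "Q = (\<Inter>i. {x. 0 \<le> x $ i} \<inter> {x. x $ i < 1})"
    by (auto simp: Q_def)
  have Q: "Q \<in> sets borel"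
    unfolding Qeq by (intro sets.countable_INT'' sets.Int) measurable
  have "emeasure lborel Q \<le> emeasure lborel (cbox (0 :: real ^ 'n) 1)"
    by (intro emeasure_mono) (auto simp: Q_def mem_box_cart less_imp_le)
  also have "\<dots> = 1"
  proof -
    have "prod ((\<bullet>) ((1 :: real ^ 'n) - 0)) Basis = 1"
      by (intro prod.neutral) (auto simp: Basis_vec_def inner_axis)
    moreover have "\<forall>i\<in>Basis. (0 :: real ^ 'n) \<bullet> i \<le> 1 \<bullet> i"
      by (auto simp: Basis_vec_def inner_axis)
    ultimately show ?thesis by (simp add: emeasure_lborel_cbox_eq)
  qed
  finally have Q1: "emeasure lborel Q \<le> 1" .
  have inQ: "x - v (\<chi> i. \<lfloor>x $ i\<rfloor>) \<in> Q" for x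
    by (auto simp: Q_def v_def) linarith
  have shift: "emeasure lborel ((\<lambda>x. x + v z) -` X) = emeasure lborel X" if "X \<in> sets borel" for X z
  proof -
    have "emeasure lborel X = emeasure (distr lborel borel (\<lambda>x. v z + x)) X"
      by (simp add: lborel_distr_plus)
    also have "\<dots> = emeasure lborel ((\<lambda>x. v z + x) -` X)"
      using that by (subst emeasure_distr) auto
    also have "(\<lambda>x. v z + x) -` X = (\<lambda>x. x + v z) -` X" by (simp add: add.commute)
    finally show ?thesis by simp
  qed
  define X where "X z = A \<inter> (\<lambda>x. x - v z) -` Q" for z
  have X: "X z \<in> sets borel" for z
    unfolding X_def using A measurable_sets_borel[OF _ Q, of "\<lambda>x. x - v z"] by auto
  define Y where "Y z = (\<lambda>x. x + v z) -` A \<inter> Q" for z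
  have YX: "Y z = (\<lambda>x. x + v z) -` X z" for z
    by (auto simp: X_def Y_def)
  have Y: "Y z \<in> sets borel" for z
    unfolding YX using measurable_sets_borel[OF _ X, of "\<lambda>x. x + v z"] by auto
  have dX: "disjoint_family X"
  unfolding disjoint_family_on_def
  proof (intro ballI impI)
    fix m n :: "int ^ 'n" assume "m \<noteq> n"
    then obtain i where i: "m $ i \<noteq> n $ i" by (auto simp: vec_eq_iff)
    show "X m \<inter> X n = {}"
    proof (rule ccontr)
      assume "X m \<inter> X n \<noteq> {}"
      then obtain x where "x \<in> X m" "x \<in> X n" by auto
      then have "0 \<le> x $ i - m $ i" "x $ i - m $ i < 1" "0 \<le> x $ i - n $ i" "x $ i - n $ i < 1"
        by (auto simp: X_def Q_def v_def)
      with i show False by linarith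
    qed
  qed
  have UX: "(\<Union>z. X z) = A"
    using inQ by (auto simp: X_def)
  have cnt: "countable (UNIV :: (int ^ 'n) set)" by simp
  show ?thesis
  proof (rule ccontr)
    assume "\<not> thesis"
    with that have no: "\<And>x z. x \<in> A \<Longrightarrow> x + z \<in> A \<Longrightarrow> \<forall>i. z $ i \<in> \<int> \<Longrightarrow> z = 0" by blast
    have dY: "disjoint_family Y"
    unfolding disjoint_family_on_def
    proof (intro ballI impI)
      fix m n :: "int ^ 'n" assume "m \<noteq> n"
      then obtain i where i: "m $ i \<noteq> n $ i" by (auto simp: vec_eq_iff)
      show "Y m \<inter> Y n = {}"
      proof (rule ccontr)
        assume "Y m \<inter> Y n \<noteq> {}"
        then obtain x where x: "x + v m \<in> A" "x + v n \<in> A" by (auto simp: Y_def)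
        have "v n - v m = 0"
          by (rule no[OF x(1)]) (use x in \<open>auto simp: v_def add.commute\<close>)
        then have "v n $ i = v m $ i" by simp
        with i show False by (simp add: v_def)
      qed
    qed
    have "emeasure lborel A = (\<integral>\<^sup>+z. emeasure lborel (X z) \<partial>count_space UNIV)"
      using emeasure_UN_countable[OF _ cnt dX, of lborel] X by (simp add: UX)
    also have "\<dots> = (\<integral>\<^sup>+z. emeasure lborel (Y z) \<partial>count_space UNIV)"
      by (simp add: YX shift X)
    also have "\<dots> = emeasure lborel (\<Union>z. Y z)"
      using emeasure_UN_countable[OF _ cnt dY, of lborel] Y by simp
    also have "\<dots> \<le> emeasure lborel Q"
      by (intro emeasure_mono) (auto simp: Y_def Q)
    finally show False using gt Q1 by simp
  qed
qed

section \<open>Short isotropic vectors\<close>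

text \<open>The coordinates of space-time. Since the index type is only assumed finite, a well-order on them
  is chosen arbitrarily: the library's volume formula for linear images requires one.\<close>
datatype 'd coord = Time | Space 'd

lemma UNIV_coord: "UNIV = insert Time (range Space)"
  by (auto intro: coord.exhaust)

instance coord :: (finite) finite
proof
  show "finite (UNIV :: 'a coord set)"
    by (subst UNIV_coord) simp
qed

lemma sum_coord: "sum f UNIV = f Time + (\<Sum>i\<in>UNIV. f (Space i))" for f :: "'d::finite coord \<Rightarrow> 'a::comm_monoid_add"
  unfolding UNIV_coord by (subst sum.insert) (auto simp: sum.reindex inj_def)

definition coord_rank :: "'d::finite coord \<Rightarrow> nat" where
  "coord_rank = (SOME f. inj f)"

lemma coord_rank_eq_iff [simp]: "coord_rank x = coord_rank y \<longleftrightarrow> x = y"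
proof -
  have "\<exists>f :: 'a coord \<Rightarrow> nat. inj f"
    using finite_imp_inj_to_nat_seg[of "UNIV :: 'a coord set"] by auto
  then have "inj (coord_rank :: 'a coord \<Rightarrow> nat)"
    unfolding coord_rank_def by (rule someI_ex)
  then show ?thesis by (simp add: inj_eq)
qed

instantiation coord :: (finite) wellorder
begin
definition "x \<le> y \<longleftrightarrow> coord_rank x \<le> coord_rank y"
definition "x < y \<longleftrightarrow> coord_rank x < coord_rank y"
instance
proof intro_classes
  fix x y z :: "'a coord"
  show "(x < y) = (x \<le> y \<and> \<not> y \<le> x)" by (auto simp only: less_eq_coord_def less_coord_def)
  show "x \<le> x" by (simp only: less_eq_coord_def)
  show "x \<le> y \<Longrightarrow> y \<le> z \<Longrightarrow> x \<le> z" by (simp only: less_eq_coord_def)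
  show "x \<le> y \<Longrightarrow> y \<le> x \<Longrightarrow> x = y"
    by (simp only: less_eq_coord_def coord_rank_eq_iff[symmetric])
  show "x \<le> y \<or> y \<le> x" by (simp only: less_eq_coord_def linear)
next
  fix P :: "'a coord \<Rightarrow> bool" and a
  assume *: "\<And>x. (\<And>y. y < x \<Longrightarrow> P y) \<Longrightarrow> P x"
  show "P a"
    by (rule measure_induct_rule[of coord_rank P]) (rule *, simp only: less_coord_def)
qed
end

text \<open>The form of signature (1, d). An integer vector with positive time \<open>q\<close> and
  space part \<open>p\<close> is isotropic exactly if \<open>p/q\<close> lies on the unit sphere;
  this turns rational points into lattice vectors.\<close>

definition lorentz_form :: "real ^ 'd::finite coord \<Rightarrow> real ^ 'd coord \<Rightarrow> real" where
  "lorentz_form x y = x $ Time * y $ Time - (\<Sum>i\<in>UNIV. x $ Space i * y $ Space i)"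

definition spatial :: "real ^ 'd::finite coord \<Rightarrow> real ^ 'd" where
  "spatial x = (\<chi> i. x $ Space i)"

definition spacetime :: "real ^ 'd::finite \<Rightarrow> real \<Rightarrow> real ^ 'd coord" where
  "spacetime p q = (\<chi> k. case k of Time \<Rightarrow> q | Space i \<Rightarrow> p $ i)"

lemma spacetime_Time [simp]: "spacetime p q $ Time = q"
  and spatial_spacetime [simp]: "spatial (spacetime p q) = p"
  by (simp_all add: spacetime_def spatial_def vec_eq_iff)

lemma inner_coord: "x \<bullet> y = x $ Time * y $ Time + spatial x \<bullet> spatial y"
  for x y :: "real ^ 'd::finite coord"
  by (simp add: inner_vec_def spatial_def sum_coord)

lemma lorentz_form_eq: "lorentz_form x y = x $ Time * y $ Time - spatial x \<bullet> spatial y"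
  for x y :: "real ^ 'd::finite coord"
  by (simp add: inner_vec_def spatial_def lorentz_form_def)

lemma linear_spatial: "linear (spatial :: real ^ 'd::finite coord \<Rightarrow> _)"
  by (auto intro!: linearI simp: spatial_def vec_eq_iff)

text \<open>For a unit vector \<alpha> and \<open>c\<^sup>2 - s\<^sup>2 = 1\<close> this is a
  hyperbolic rotation, with matrix rows \<open>c s\<close> and \<open>s c\<close>, in the plane of
  the time axis and \<alpha>; the space directions orthogonal to \<alpha> are fixed.\<close>

definition boost :: "real ^ 'd::finite \<Rightarrow> real \<Rightarrow> real \<Rightarrow> real ^ 'd coord \<Rightarrow> real ^ 'd coord" where
  "boost \<alpha> c s x = spacetime (spatial x + (s * x $ Time + (c - 1) * (spatial x \<bullet> \<alpha>)) *\<^sub>R \<alpha>)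
     (c * x $ Time + s * (spatial x \<bullet> \<alpha>))"

lemma linear_boost: "linear (boost \<alpha> c s)" for \<alpha> :: "real ^ 'd::finite"
  by (rule linearI; simp add: vec_eq_iff boost_def spacetime_def spatial_def inner_vec_def
      sum.distrib sum_distrib_left algebra_simps split: coord.splits)

lemma lorentz_form_boost:
  fixes \<alpha> :: "real ^ 'd::finite"
  assumes \<alpha>: "norm \<alpha> = 1" and cs: "c\<^sup>2 - s\<^sup>2 = 1"
  shows "lorentz_form (boost \<alpha> c s x) (boost \<alpha> c s y) = lorentz_form x y"
proof -
  have 1: "\<alpha> \<bullet> \<alpha> = 1" using \<alpha> by (simp add: dot_square_norm)
  have key: "(X + l *\<^sub>R \<alpha>) \<bullet> (Y + m *\<^sub>R \<alpha>) = X \<bullet> Y + m * (X \<bullet> \<alpha>) + l * (Y \<bullet> \<alpha>) + l * m" for X Y l m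
    by (simp add: inner_add_left inner_add_right 1 inner_commute[of \<alpha> Y] distrib_left mult.commute[of l m])
  \<comment> \<open>Here \<open>q\<close>, \<open>r\<close> are the times, \<open>a\<close>,
    \<open>b\<close> the components along \<alpha>, and \<open>z\<close> is the inner product of the
    space parts of the two vectors.\<close>
  have alg: "(c * q + s * a) * (c * r + s * b) - (z + (s * r + (c - 1) * b) * a
       + (s * q + (c - 1) * a) * b + (s * q + (c - 1) * a) * (s * r + (c - 1) * b))
     = (c\<^sup>2 - s\<^sup>2) * (q * r - a * b) + a * b - z" for a b q r z
    by (simp add: algebra_simps power2_eq_square)
  show ?thesis
    unfolding lorentz_form_eq boost_def spacetime_Time spatial_spacetime key alg cs by simp
qed

text \<open>Reversing the space part is an isometry that turns the form into the inner product, so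
  this is the Cauchy--Schwarz inequality.\<close>

lemma abs_lorentz_form_le: "\<bar>lorentz_form x y\<bar> \<le> norm x * norm y"
  for x y :: "real ^ 'd::finite coord"
proof -
  define y' where "y' = spacetime (- spatial y) (y $ Time)"
  have "norm y' = norm y"
    by (simp add: norm_eq_sqrt_inner inner_coord y'_def)
  moreover have "lorentz_form x y = x \<bullet> y'"
    by (simp add: lorentz_form_eq inner_coord y'_def)
  ultimately show ?thesis
    using Cauchy_Schwarz_ineq2[of x y'] by simp
qed

lemma lorentz_form_sum:
  "lorentz_form (\<Sum>i\<in>I. c i *\<^sub>R f i) (\<Sum>j\<in>I. d j *\<^sub>R h j) = (\<Sum>i\<in>I. \<Sum>j\<in>I. c i * d j * lorentz_form (f i) (h j))"
  for f :: "'i \<Rightarrow> real ^ 'd::finite coord"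
proof -
  have eq: "lorentz_form x y = x \<bullet> spacetime (- spatial y) (y $ Time)" for x y :: "real ^ 'd coord"
    by (simp add: lorentz_form_eq inner_coord)
  have eq': "lorentz_form x y = lorentz_form y x" for x y :: "real ^ 'd coord"
    by (simp add: lorentz_form_eq inner_commute mult.commute)
  have l: "lorentz_form (\<Sum>i\<in>I. c i *\<^sub>R f i) y = (\<Sum>i\<in>I. c i * lorentz_form (f i) y)"
    for c :: "'i \<Rightarrow> real" and f :: "'i \<Rightarrow> real ^ 'd coord" and y
    by (simp add: eq inner_sum_left)
  have r: "lorentz_form y (\<Sum>i\<in>I. c i *\<^sub>R f i) = (\<Sum>i\<in>I. c i * lorentz_form y (f i))"
    for c :: "'i \<Rightarrow> real" and f :: "'i \<Rightarrow> real ^ 'd coord" and y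
    unfolding eq'[of y] by (rule l)
  show ?thesis
    by (simp only: l) (simp add: r sum_distrib_left mult.assoc)
qed

text \<open>A map that preserves the form satisfies \<open>G^T J G = J\<close> for the matrix
  \<open>J\<close> of the form, and \<open>det J\<close> is not zero because \<open>J\<close> is an
  involution. Boosts therefore preserve volume.\<close>

lemma det_boost:
  fixes \<alpha> :: "real ^ 'd::finite"
  assumes "norm \<alpha> = 1" "c\<^sup>2 - s\<^sup>2 = 1"
  shows "\<bar>det (matrix (boost \<alpha> c s))\<bar> = 1"
proof -
  define J :: "real ^ 'd coord \<Rightarrow> real ^ 'd coord" where "J x = spacetime (- spatial x) (x $ Time)" for x
  have lJ: "linear J"
    by (auto intro!: linearI simp: vec_eq_iff J_def spacetime_def spatial_def split: coord.splits)
  have Jform: "lorentz_form x y = x \<bullet> J y" for x y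
    by (simp add: lorentz_form_eq inner_coord J_def)
  have "J \<circ> J = id"
    by (auto simp: J_def fun_eq_iff vec_eq_iff spacetime_def spatial_def split: coord.splits)
  then have "matrix J ** matrix J = mat 1"
    using matrix_compose[OF lJ lJ] by (simp add: matrix_id_mat_1)
  then have "det (matrix J) * det (matrix J) = 1"
    using det_mul[of "matrix J" "matrix J"] by (simp add: det_I)
  then have J0: "det (matrix J) \<noteq> 0" by auto
  define G where "G = matrix (boost \<alpha> c s)"
  have G: "boost \<alpha> c s x = G *v x" for x
    by (simp add: G_def matrix_works linear_boost linear_matrix_vector_mul_eq)
  have JM: "J x = matrix J *v x" for x by (simp add: matrix_works lJ)
  have tr: "x \<bullet> (transpose G *v w) = (G *v x) \<bullet> w" for x w
    using dot_lmul_matrix[of w G x] by (simp add: transpose_matrix_vector inner_commute)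
  have "x \<bullet> ((transpose G ** matrix J ** G) *v y) = x \<bullet> (matrix J *v y)" for x y
  proof -
    have "x \<bullet> (matrix J *v y) = lorentz_form (G *v x) (G *v y)"
      using lorentz_form_boost[OF assms, of x y] by (simp add: G Jform JM)
    also have "\<dots> = x \<bullet> ((transpose G ** matrix J ** G) *v y)"
      by (simp only: Jform JM matrix_vector_mul_assoc[symmetric] tr)
    finally show ?thesis by simp
  qed
  then have "(transpose G ** matrix J ** G) *v y = matrix J *v y" for y
    using vector_eq_ldot by blast
  then have "transpose G ** matrix J ** G = matrix J"
    by (subst matrix_eq) blast
  then have "det (transpose G ** matrix J ** G) = det (matrix J)" by (rule arg_cong)
  then have "det G * det (matrix J) * det G = det (matrix J)"
    by (simp only: det_mul det_transpose)
  with J0 have "(det G)\<^sup>2 = 1" by (simp add: power2_eq_square)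
  then show ?thesis by (simp add: G_def abs_square_eq_1)
qed

section \<open>Integer combinations of lattice vectors\<close>

lemma det_in_Ints: "(\<forall>i j. A $ i $ j \<in> \<int>) \<Longrightarrow> det A \<in> \<int>" for A :: "real ^ 'n ^ 'n"
  unfolding det_def by (intro Ints_sum Ints_mult Ints_prod) auto

text \<open>By Cramer's rule the solution of \<open>Z x = e\<close> has determinants of integer
  matrices over \<open>det Z\<close> as coordinates, and the factor \<open>det Z\<close> clears the
  denominator.\<close>

lemma integer_combination:
  fixes Z :: "real ^ 'n ^ 'n" and e :: "real ^ 'n"
  assumes Z: "\<forall>i j. Z $ i $ j \<in> \<int>" and e: "\<forall>i. e $ i \<in> \<int>" and det: "det Z \<noteq> 0"
  obtains c where "\<forall>i. c $ i \<in> \<int>" "Z *v c = det Z *\<^sub>R e"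
proof
  let ?c = "\<chi> k. det (\<chi> i j. if j = k then e $ i else Z $ i $ j)"
  show "\<forall>i. ?c $ i \<in> \<int>"
    using Z e by (auto intro!: det_in_Ints)
  define x where "x = (\<chi> k. det (\<chi> i j. if j = k then e $ i else Z $ i $ j) / det Z)"
  have "?c = det Z *\<^sub>R x"
    using det by (simp add: x_def vec_eq_iff)
  moreover have "Z *v x = e"
    using cramer[OF det] unfolding x_def by blast
  ultimately show "Z *v ?c = det Z *\<^sub>R e"
    by (simp add: matrix_vector_mult_scaleR)
qed

lemma spanning_matrix:
  fixes S :: "(real ^ 'n) set"
  assumes "span S = UNIV"
  obtains Z :: "real ^ 'n ^ 'n" where "\<forall>j. column j Z \<in> S" "det Z \<noteq> 0"
proof -
  obtain B where B: "B \<subseteq> S" "independent B" "S \<subseteq> span B" "card B = dim S"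
    by (rule basis_exists)
  have "dim S = CARD('n)"
    using dim_span[of S] assms by simp
  moreover have "finite B" using B(2) by (rule independent_imp_finite)
  ultimately obtain f :: "'n \<Rightarrow> real ^ 'n" where f: "bij_betw f UNIV B"
    using B(4) finite_same_card_bij[of "UNIV :: 'n set" B] by auto
  define Z where "Z = (\<chi> i j. f j $ i)"
  have col: "column j Z = f j" for j
    by (simp add: column_def Z_def vec_eq_iff)
  have "columns Z = B"
    using f by (auto simp: columns_def col bij_betw_def)
  moreover have "span B = UNIV"
    using span_mono[OF B(3)] assms by (simp add: span_span top.extremum_uniqueI)
  ultimately have "det Z \<noteq> 0"
    by (simp add: matrix_right_invertible_span_columns invertible_det_nz[symmetric] invertible_right_inverse span_vec_eq)
  moreover have "column j Z \<in> S" for j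
    using f B(1) by (auto simp: col bij_betw_def)
  ultimately show ?thesis using that by blast
qed

text \<open>A vector with integer coordinates and \<open>norm (boost \<alpha> c s x) < 1\<close> is isotropic because the form
  takes integer values. If there is none, the theorem of Blichfeldt, applied to the preimage of a pile of small
  balls in the direction of a hyperplane normal, forbids that hyperplane to contain all short lattice vectors.\<close>

lemma short_or_spanning:
  "\<exists>R. \<forall>(\<alpha> :: real ^ 'd::finite) c s. norm \<alpha> = 1 \<longrightarrow> c\<^sup>2 - s\<^sup>2 = 1 \<longrightarrow>
    (\<exists>x. x \<noteq> 0 \<and> (\<forall>i. x $ i \<in> \<int>) \<and> norm (boost \<alpha> c s x) < 1) \<or>
    span {x. (\<forall>i. x $ i \<in> \<int>) \<and> norm (boost \<alpha> c s x) \<le> R} = UNIV"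
proof -
  define w where "w = measure lborel (ball (0 :: real ^ 'd coord) (1/8))"
  have w: "w > 0"
    unfolding w_def by (subst content_ball_pos) auto
  \<comment> \<open>\<open>J\<close> balls of radius 1/8 have total volume above 1.\<close>
  obtain J :: nat where J: "1 / w < J" using reals_Archimedean2 by blast
  \<comment> \<open>\<open>J / 4\<close> bounds the distance of two centres of the pile, and the 1
    exceeds the error caused by the two radii.\<close>
  define R where "R = real J / 4 + 1"
  have "(\<exists>x. x \<noteq> 0 \<and> (\<forall>i. x $ i \<in> \<int>) \<and> norm (boost \<alpha> c s x) < 1) \<or>
    span {x. (\<forall>i. x $ i \<in> \<int>) \<and> norm (boost \<alpha> c s x) \<le> R} = UNIV"
    if \<alpha>: "norm \<alpha> = 1" and cs: "c\<^sup>2 - s\<^sup>2 = 1" for \<alpha> :: "real ^ 'd" and c s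
  proof (rule disjCI)
    let ?g = "boost \<alpha> c s"
    define S where "S = {x. (\<forall>i. x $ i \<in> \<int>) \<and> norm (boost \<alpha> c s x) \<le> R}"
    assume "span {x. (\<forall>i. x $ i \<in> \<int>) \<and> norm (boost \<alpha> c s x) \<le> R} \<noteq> UNIV"
    then have "span S \<noteq> UNIV" by (simp add: S_def)
    then have "dim S \<noteq> DIM(real ^ 'd coord)"
      by (metis dim_eq_full)
    moreover have "dim S \<le> DIM(real ^ 'd coord)"
      by (rule dim_subset_UNIV)
    ultimately have "dim (?g ` S) < DIM(real ^ 'd coord)"
      using dim_image_le[OF linear_boost, of \<alpha> c s S] by linarith
    then have "span (?g ` S) \<noteq> UNIV"
      by (metis dim_eq_full nless_le)
    then obtain b0 where b0: "b0 \<noteq> 0" "span (?g ` S) \<subseteq> {x. b0 \<bullet> x = 0}"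
      using span_not_univ_subset_hyperplane by blast
    define b where "b = b0 /\<^sub>R norm b0"
    have b1: "norm b = 1" using b0 by (simp add: b_def)
    have b: "b \<bullet> ?g x = 0" if "x \<in> S" for x
      using b0(2) that span_superset[of "?g ` S"] by (auto simp: b_def)
    \<comment> \<open>The centres have spacing 1/4 along the unit normal \<open>b\<close>, so radius
      1/8 makes the balls disjoint.\<close>
    define D :: "nat \<Rightarrow> (real ^ 'd coord) set" where "D j = ball ((real j / 4) *\<^sub>R b) (1/8)" for j
    have disj: "disjoint_family D"
    unfolding disjoint_family_on_def
    proof (intro ballI impI)
      fix i j :: nat assume "i \<noteq> j"
      have "dist ((real i / 4) *\<^sub>R b) ((real j / 4) *\<^sub>R b) = norm ((real i / 4 - real j / 4) *\<^sub>R b)"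
        by (simp add: dist_norm scaleR_diff_left)
      also have "\<dots> = \<bar>real i / 4 - real j / 4\<bar>" using b1 by simp
      also have "\<dots> \<ge> 1/4" using \<open>i \<noteq> j\<close> by (cases "i < j") auto
      finally show "D i \<inter> D j = {}"
        unfolding D_def by (intro disjoint_ballI) auto
    qed
    define U where "U = (\<Union>j<J. D j)"
    have "measure lborel U = (\<Sum>j<J. measure lborel (D j))"
      unfolding U_def
      by (intro measure_finite_Union disjoint_family_on_mono[OF _ disj])
        (use emeasure_lborel_ball_finite in \<open>auto simp: D_def less_top\<close>)
    also have "\<dots> = real J * w"
      by (simp add: D_def w_def content_ball)
    finally have U1: "measure lborel U > 1" using J w by (simp add: field_simps)
    have oU: "open U" by (auto simp: U_def D_def)
    have Ulm: "U \<in> lmeasurable"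
      unfolding U_def D_def by (intro fmeasurable.finite_UN) auto
    have det: "det (matrix ?g) \<noteq> 0"
      using det_boost[OF \<alpha> cs] by auto
    have lin: "linear ?g" by (rule linear_boost)
    have inj: "inj ?g"
      using det det_nz_iff_inj[OF lin] by blast
    have surj: "surj ?g"
      by (rule linear_inj_imp_surj[OF lin inj])
    have oA: "open (?g -` U)"
      using oU lin by (intro open_vimage linear_continuous_on) (auto simp: linear_conv_bounded_linear)
    obtain h where h: "linear h" "\<forall>x. h (?g x) = x" "\<forall>x. ?g (h x) = x"
      using linear_injective_isomorphism[OF lin inj] by blast
    \<comment> \<open>As the image of \<open>U\<close> under the inverse \<open>h\<close> of the
      boost, whose determinant is 1 in absolute value, the preimage has the volume of
      \<open>U\<close>.\<close>
    have hA: "?g -` U = h ` U"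
      using h(2,3) unfolding vimage_def image_def by (intro Collect_cong) metis
    have comp: "h \<circ> ?g = id" using h(2) by auto
    have "det (matrix h) * det (matrix ?g) = 1"
      by (metis det_I det_mul h(1) comp lin matrix_compose matrix_id_mat_1)
    then have "\<bar>det (matrix h)\<bar> * \<bar>det (matrix ?g)\<bar> = 1"
      by (simp flip: abs_mult)
    then have "\<bar>det (matrix h)\<bar> = 1"
      using det_boost[OF \<alpha> cs] by simp
    then have lmA: "?g -` U \<in> lmeasurable" and "measure lebesgue (?g -` U) = measure lebesgue U"
      using measurable_linear_image[OF h(1) Ulm] measure_linear_image[OF h(1) Ulm] by (auto simp: hA)
    moreover have "measure lebesgue U = measure lborel U"
      using oU by (intro measure_completion) auto
    ultimately have "emeasure lebesgue (?g -` U) > 1"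
      using U1 emeasure_eq_measure2[OF lmA] by simp
    then have "emeasure lborel (?g -` U) > 1"
      using oA emeasure_completion[of "?g -` U" lborel] by simp
    then obtain x z where xz: "?g x \<in> U" "?g (x + z) \<in> U" "z \<noteq> 0" "\<forall>i. z $ i \<in> \<int>"
      using blichfeldt[of "?g -` U"] oA borel_open[OF oA] unfolding vimage_def mem_Collect_eq by metis
    then obtain i j where ij: "i < J" "?g x \<in> D i" "j < J" "?g (x + z) \<in> D j"
      by (auto simp: U_def)
    define r where "r = real j / 4 - real i / 4"
    define d where "d = ?g z - r *\<^sub>R b"
    define d1 d2 where "d1 = ?g (x + z) - (real j / 4) *\<^sub>R b" and "d2 = ?g x - (real i / 4) *\<^sub>R b"
    have "d = d1 - d2"
      by (simp add: d1_def d2_def d_def r_def linear_add[OF lin] algebra_simps)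
    moreover have "norm d1 < 1/8" "norm d2 < 1/8"
      using ij by (auto simp: d1_def d2_def D_def dist_norm norm_minus_commute)
    ultimately have d: "norm d < 1/4"
      using norm_triangle_ineq4[of d1 d2] by simp
    have gz: "?g z = r *\<^sub>R b + d" by (simp add: d_def)
    have "norm (?g z) \<le> \<bar>r\<bar> + norm d"
      using norm_triangle_ineq[of "r *\<^sub>R b" d] b1 by (simp add: gz)
    moreover have "\<bar>r\<bar> \<le> real J / 4" using ij by (simp add: r_def abs_if)
    ultimately have "norm (?g z) \<le> R" using d by (simp add: R_def)
    then have "z \<in> S" using xz(4) by (simp add: S_def)
    \<comment> \<open>By its length \<open>z\<close> belongs to \<open>S\<close>, so its image is
      orthogonal to \<open>b\<close>. The multiple \<open>r\<close> of \<open>b\<close> must be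
      cancelled by the component of \<open>d\<close> along \<open>b\<close>, which makes both parts
      shorter than 1/4.\<close>
    then have "b \<bullet> (r *\<^sub>R b + d) = 0" using b gz by metis
    then have "r = - (b \<bullet> d)" using b1 by (simp add: inner_add_right dot_square_norm)
    then have "\<bar>r\<bar> \<le> norm d" using Cauchy_Schwarz_ineq2[of b d] b1 by simp
    with \<open>norm (?g z) \<le> \<bar>r\<bar> + norm d\<close> d have "norm (?g z) < 1" by simp
    with xz show "\<exists>x. x \<noteq> 0 \<and> (\<forall>i. x $ i \<in> \<int>) \<and> norm (?g x) < 1" by blast
  qed
  then show ?thesis by blast
qed

lemma finite_bounded_Ints_functions: "finite {\<Gamma> :: 'a::finite \<Rightarrow> 'b::finite \<Rightarrow> real. \<forall>i j. \<Gamma> i j \<in> \<int> \<and> \<bar>\<Gamma> i j\<bar> \<le> b}"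
proof -
  have K: "finite {k :: real. k \<in> \<int> \<and> \<bar>k\<bar> \<le> b}"
    by (rule finite_abs_int_segment)
  have "finite (Pi\<^sub>E (UNIV :: 'a set) (\<lambda>_. Pi\<^sub>E (UNIV :: 'b set) (\<lambda>_. {k :: real. k \<in> \<int> \<and> \<bar>k\<bar> \<le> b})))"
    by (intro finite_PiE K) auto
  then show ?thesis
    by (rule rev_finite_subset) auto
qed

text \<open>A vector with time 1 and a single space coordinate 1 is isotropic, and its multiple by
  \<open>det Z\<close> is an integer combination of the columns. The columns enter the equation only
  through their Gram matrix, so the same coefficients serve every system with that Gram
  matrix.\<close>

lemma isotropic_combination:
  fixes Z :: "real ^ 'd::finite coord ^ 'd coord"
  assumes Z: "\<forall>i j. Z $ i $ j \<in> \<int>" and det: "det Z \<noteq> 0"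
  shows "\<exists>c. (\<forall>i. c i \<in> \<int>) \<and> (\<exists>i. c i \<noteq> 0) \<and>
    (\<Sum>i\<in>UNIV. \<Sum>j\<in>UNIV. c i * c j * lorentz_form (column i Z) (column j Z)) = 0"
proof -
  \<comment> \<open>\<open>undefined\<close> stands for an arbitrary space coordinate.\<close>
  define e :: "real ^ 'd coord" where "e = spacetime (axis undefined 1) 1"
  have "\<forall>i. e $ i \<in> \<int>"
    by (auto simp: e_def spacetime_def axis_def split: coord.splits)
  then obtain c where c: "\<forall>i. c $ i \<in> \<int>" "Z *v c = det Z *\<^sub>R e"
    using integer_combination[OF Z _ det] by blast
  have "e $ Time = 1" by (simp add: e_def)
  then have "Z *v c \<noteq> 0" using c(2) det by auto
  then have "c \<noteq> 0" by auto
  then have ne: "\<exists>i. c $ i \<noteq> 0" by (auto simp: vec_eq_iff)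
  have comb: "Z *v c = (\<Sum>i\<in>UNIV. c $ i *\<^sub>R column i Z)"
    by (simp add: matrix_mult_sum scalar_mult_eq_scaleR)
  have "lorentz_form e e = 0"
    by (simp add: lorentz_form_eq e_def inner_axis)
  then have "lorentz_form (Z *v c) (Z *v c) = 0"
    by (simp add: c(2) lorentz_form_eq linear_scale[OF linear_spatial])
  then have "(\<Sum>i\<in>UNIV. \<Sum>j\<in>UNIV. c $ i * c $ j * lorentz_form (column i Z) (column j Z)) = 0"
    unfolding comb lorentz_form_sum .
  with c(1) ne show ?thesis by (intro exI[of _ "\<lambda>i. c $ i"] conjI) assumption+
qed

lemma lorentz_form_Ints: "\<forall>i. x $ i \<in> \<int> \<Longrightarrow> \<forall>i. y $ i \<in> \<int> \<Longrightarrow> lorentz_form x y \<in> \<int>"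
  unfolding lorentz_form_def by (intro Ints_diff Ints_mult Ints_sum) auto

text \<open>The Gram matrix of a spanning system of short integer vectors is an integer matrix of bounded size,
  and the coefficients of an isotropic combination can be chosen to depend on the Gram matrix only.\<close>

lemma short_isotropic:
  "\<exists>C. \<forall>(\<alpha> :: real ^ 'd::finite) c s. norm \<alpha> = 1 \<longrightarrow> c\<^sup>2 - s\<^sup>2 = 1 \<longrightarrow>
    (\<exists>x. x \<noteq> 0 \<and> (\<forall>i. x $ i \<in> \<int>) \<and> lorentz_form x x = 0 \<and> norm (boost \<alpha> c s x) \<le> C)"
proof -
  obtain R where R: "\<forall>(\<alpha> :: real ^ 'd) c s. norm \<alpha> = 1 \<longrightarrow> c\<^sup>2 - s\<^sup>2 = 1 \<longrightarrow>
    (\<exists>x. x \<noteq> 0 \<and> (\<forall>i. x $ i \<in> \<int>) \<and> norm (boost \<alpha> c s x) < 1) \<or>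
    span {x. (\<forall>i. x $ i \<in> \<int>) \<and> norm (boost \<alpha> c s x) \<le> R} = UNIV"
    using short_or_spanning by (rule exE)
  define G where "G = {\<Gamma> :: 'd coord \<Rightarrow> 'd coord \<Rightarrow> real. \<forall>i j. \<Gamma> i j \<in> \<int> \<and> \<bar>\<Gamma> i j\<bar> \<le> R * R}"
  have finG: "finite G" unfolding G_def by (rule finite_bounded_Ints_functions)
  define P where "P \<Gamma> c \<longleftrightarrow> (\<forall>i. c i \<in> \<int>) \<and> (\<exists>i. c i \<noteq> 0) \<and> (\<Sum>i\<in>UNIV. \<Sum>j\<in>UNIV. c i * c j * \<Gamma> i j) = 0"
    for \<Gamma> :: "'d coord \<Rightarrow> 'd coord \<Rightarrow> real" and c :: "'d coord \<Rightarrow> real"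
  \<comment> \<open>The choice sees only the Gram matrix; since \<open>G\<close> is finite, the
    coefficients are bounded uniformly in \<alpha>, \<open>c\<close> and \<open>s\<close>.\<close>
  define cf where "cf \<Gamma> = (SOME c. P \<Gamma> c)" for \<Gamma>
  \<comment> \<open>The sum over all of \<open>G\<close> bounds the combination for whichever Gram
    matrix occurs; the 1 covers the case of a vector shorter than 1.\<close>
  define C where "C = 1 + (\<Sum>\<Gamma>\<in>G. \<Sum>i\<in>UNIV. \<bar>cf \<Gamma> i\<bar> * \<bar>R\<bar>)"
  have C1: "C \<ge> 1" unfolding C_def by (simp add: sum_nonneg)
  have "\<exists>x. x \<noteq> 0 \<and> (\<forall>i. x $ i \<in> \<int>) \<and> lorentz_form x x = 0 \<and> norm (boost \<alpha> c s x) \<le> C"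
    if \<alpha>: "norm \<alpha> = 1" and cs: "c\<^sup>2 - s\<^sup>2 = 1" for \<alpha> :: "real ^ 'd" and c s
    using R[rule_format, OF \<alpha> cs]
  proof
    assume "\<exists>x. x \<noteq> 0 \<and> (\<forall>i. x $ i \<in> \<int>) \<and> norm (boost \<alpha> c s x) < 1"
    then obtain x where x: "x \<noteq> 0" "\<forall>i. x $ i \<in> \<int>" "norm (boost \<alpha> c s x) < 1" by blast
    have "\<bar>lorentz_form x x\<bar> \<le> norm (boost \<alpha> c s x) * norm (boost \<alpha> c s x)"
      using abs_lorentz_form_le[of "boost \<alpha> c s x" "boost \<alpha> c s x"] by (simp add: lorentz_form_boost[OF \<alpha> cs])
    also have "\<dots> < 1 * 1" using x(3) by (intro mult_strict_mono') auto
    finally have "lorentz_form x x = 0"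
      using Ints_nonzero_abs_less1[OF lorentz_form_Ints[OF x(2) x(2)]] by simp
    with x C1 show ?thesis by (intro exI[of _ x]) auto
  next
    let ?S = "{x. (\<forall>i. x $ i \<in> \<int>) \<and> norm (boost \<alpha> c s x) \<le> R}"
    assume "span ?S = UNIV"
    then obtain Z :: "real ^ 'd coord ^ 'd coord" where Z: "\<forall>j. column j Z \<in> ?S" and det: "det Z \<noteq> 0"
      by (rule spanning_matrix)
    have R0: "R \<ge> 0" using Z order_trans[OF norm_ge_zero] by blast
    have Zint: "\<forall>i j. Z $ i $ j \<in> \<int>" using Z by (simp add: column_def)
    define \<Gamma> where "\<Gamma> i j = lorentz_form (column i Z) (column j Z)" for i j
    have bound: "\<bar>\<Gamma> i j\<bar> \<le> R * R" for i j
    proof -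
      have "\<bar>\<Gamma> i j\<bar> \<le> norm (boost \<alpha> c s (column i Z)) * norm (boost \<alpha> c s (column j Z))"
        using abs_lorentz_form_le[of "boost \<alpha> c s (column i Z)" "boost \<alpha> c s (column j Z)"]
        by (simp add: lorentz_form_boost[OF \<alpha> cs] \<Gamma>_def)
      also have "\<dots> \<le> R * R" using Z R0 by (intro mult_mono) auto
      finally show ?thesis .
    qed
    have "\<Gamma> i j \<in> \<int>" for i j
      unfolding \<Gamma>_def using Z by (intro lorentz_form_Ints) auto
    with bound have "\<Gamma> \<in> G" by (simp add: G_def)
    have "P \<Gamma> (cf \<Gamma>)"
      unfolding cf_def using isotropic_combination[OF Zint det] by (intro someI_ex[of "P \<Gamma>"]) (simp add: P_def \<Gamma>_def)
    then have cf: "\<And>i. cf \<Gamma> i \<in> \<int>" "\<exists>i. cf \<Gamma> i \<noteq> 0"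
        "(\<Sum>i\<in>UNIV. \<Sum>j\<in>UNIV. cf \<Gamma> i * cf \<Gamma> j * \<Gamma> i j) = 0"
      by (auto simp: P_def)
    define x where "x = (\<Sum>i\<in>UNIV. cf \<Gamma> i *\<^sub>R column i Z)"
    have xZ: "x = Z *v (\<chi> i. cf \<Gamma> i)"
      by (simp add: x_def matrix_mult_sum scalar_mult_eq_scaleR)
    have "lorentz_form x x = 0"
      using cf(3) unfolding x_def lorentz_form_sum \<Gamma>_def .
    moreover have "\<forall>k. x $ k \<in> \<int>"
      unfolding x_def using cf(1) Zint by (auto simp: column_def intro!: Ints_sum Ints_mult)
    moreover have "x \<noteq> 0"
    proof
      assume "x = 0"
      have "invertible Z" using det by (simp add: invertible_det_nz)
      then obtain A where "A ** Z = mat 1" unfolding invertible_def by blast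
      then have "(\<chi> i. cf \<Gamma> i) = A *v x"
        by (simp add: xZ matrix_vector_mul_assoc)
      with \<open>x = 0\<close> have "(\<chi> i. cf \<Gamma> i) = 0" by simp
      with cf(2) show False by (auto simp: vec_eq_iff)
    qed
    moreover have "norm (boost \<alpha> c s x) \<le> C"
    proof -
      have "boost \<alpha> c s x = (\<Sum>i\<in>UNIV. cf \<Gamma> i *\<^sub>R boost \<alpha> c s (column i Z))"
        unfolding x_def by (simp add: linear_sum[OF linear_boost] linear_scale[OF linear_boost])
      also have "norm \<dots> \<le> (\<Sum>i\<in>UNIV. norm (cf \<Gamma> i *\<^sub>R boost \<alpha> c s (column i Z)))"
        by (rule norm_sum)
      also have "\<dots> \<le> (\<Sum>i\<in>UNIV. \<bar>cf \<Gamma> i\<bar> * \<bar>R\<bar>)"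
        using Z R0 by (intro sum_mono) (auto intro!: mult_left_mono)
      also have "\<dots> \<le> (\<Sum>\<Gamma>\<in>G. \<Sum>i\<in>UNIV. \<bar>cf \<Gamma> i\<bar> * \<bar>R\<bar>)"
        by (rule member_le_sum[OF \<open>\<Gamma> \<in> G\<close> _ finG]) (auto intro!: sum_nonneg)
      finally show ?thesis by (simp add: C_def)
    qed
    ultimately show ?thesis by blast
  qed
  then show ?thesis by blast
qed

section \<open>Dirichlet's theorem on the sphere\<close>

text \<open>With \<open>c - s = T\<close> and \<open>c + s = 1 / T\<close> the boost multiplies \<open>q - p \<bullet> \<alpha>\<close> by \<open>T\<close> and divides
  \<open>q + p \<bullet> \<alpha>\<close> by \<open>T\<close>.\<close>

theorem dirichlet_sphere:
  "\<exists>C \<ge> 1. \<forall>\<alpha> :: real ^ 'd::finite. norm \<alpha> = 1 \<longrightarrow> (\<forall>T \<ge> 1. \<exists>p q. q \<ge> 1 \<and> real q \<le> C * T \<and>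
    norm (rat_point p q :: real ^ 'd) = 1 \<and> (dist \<alpha> (rat_point p q))\<^sup>2 \<le> C / (real q * T))"
proof -
  obtain D where D: "\<And>(\<alpha> :: real ^ 'd) c s. norm \<alpha> = 1 \<Longrightarrow> c\<^sup>2 - s\<^sup>2 = 1 \<Longrightarrow>
    (\<exists>x. x \<noteq> 0 \<and> (\<forall>i. x $ i \<in> \<int>) \<and> lorentz_form x x = 0 \<and> norm (boost \<alpha> c s x) \<le> D)"
    using short_isotropic by metis
  define C where "C = 4 * max 1 D"
  have "\<exists>p q. q \<ge> 1 \<and> real q \<le> C * T \<and>
      norm (rat_point p q :: real ^ 'd) = 1 \<and> (dist \<alpha> (rat_point p q))\<^sup>2 \<le> C / (real q * T)"
    if \<alpha>: "norm \<alpha> = 1" and T: "T \<ge> 1" for \<alpha> :: "real ^ 'd" and T :: real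
  proof -
    define c s where "c = (T + 1/T) / 2" and "s = (1/T - T) / 2"
    have cms: "c - s = T" and cps: "c + s = 1 / T"
      by (simp_all add: c_def s_def field_simps)
    have "c\<^sup>2 - s\<^sup>2 = (c - s) * (c + s)"
      by (simp add: power2_eq_square algebra_simps)
    then have cs: "c\<^sup>2 - s\<^sup>2 = 1" using T by (simp add: cms cps)
    obtain x0 where x0: "x0 \<noteq> 0" "\<forall>i. x0 $ i \<in> \<int>" "lorentz_form x0 x0 = 0" "norm (boost \<alpha> c s x0) \<le> D"
      using D[OF \<alpha> cs] by blast
    \<comment> \<open>Passing to the negative changes neither isotropy nor the length of the image
      and makes the denominator non-negative.\<close>
    define x where "x = (if x0 $ Time < 0 then - x0 else x0)"
    have x: "x \<noteq> 0" "\<forall>i. x $ i \<in> \<int>" "lorentz_form x x = 0" "norm (boost \<alpha> c s x) \<le> D" "x $ Time \<ge> 0"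
      using x0 linear_neg[OF linear_boost, of \<alpha> c s x0]
      by (auto simp: x_def lorentz_form_def)
    define q p a where "q = x $ Time" and "p = spatial x" and "a = p \<bullet> \<alpha>"
    have pq: "p \<bullet> p = q * q"
      using x(3) by (simp add: lorentz_form_eq p_def q_def)
    have "q \<noteq> 0"
    proof
      assume "q = 0"
      then have "p = 0" using pq by simp
      with \<open>q = 0\<close> have "x \<bullet> x = 0" by (simp add: inner_coord p_def q_def)
      with x(1) show False by simp
    qed
    with x(5) have q0: "q > 0" by (simp add: q_def)
    have "q \<in> \<int>" using x(2) by (simp add: q_def)
    then obtain m :: int where "q = of_int m" by (rule Ints_cases)
    with q0 have q: "q = real (nat m)" "nat m \<ge> 1" by auto
    define p' :: "int ^ 'd" where "p' = (\<chi> i. \<lfloor>p $ i\<rfloor>)"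
    have p': "real_of_int (p' $ i) = p $ i" for i
      using x(2) by (simp add: p'_def p_def spatial_def)
    have rp: "rat_point p' (nat m) = p /\<^sub>R q"
      by (simp add: rat_point_def p' vec_eq_iff q divide_inverse mult.commute)
    have 1: "\<alpha> \<bullet> \<alpha> = 1" using \<alpha> by (simp add: dot_square_norm)
    \<comment> \<open>Time and \<alpha>-component of the short boosted vector; \<open>u - v\<close>
      and \<open>u + v\<close> are \<open>T\<close> times \<open>q - a\<close> and
      \<open>1 / T\<close> times \<open>q + a\<close>.\<close>
    define u v where "u = boost \<alpha> c s x $ Time" and "v = spatial (boost \<alpha> c s x) \<bullet> \<alpha>"
    have "u = c * q + s * a" by (simp add: u_def boost_def q_def a_def p_def)
    moreover have "v = s * q + c * a"
      by (simp add: v_def boost_def q_def a_def p_def inner_add_left 1 algebra_simps)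
    ultimately have "u - v = (c - s) * (q - a)" "u + v = (c + s) * (q + a)"
      by (simp_all add: algebra_simps)
    then have uv: "q - a = (u - v) / T" "q + a = (u + v) * T"
      using T by (simp_all add: cms cps)
    have "norm (spatial (boost \<alpha> c s x)) \<le> norm (boost \<alpha> c s x)"
      by (simp add: norm_eq_sqrt_inner inner_coord)
    then have "\<bar>u\<bar> \<le> D" "\<bar>v\<bar> \<le> D"
      using x(4) Finite_Cartesian_Product.norm_nth_le[of "boost \<alpha> c s x" Time]
        Cauchy_Schwarz_ineq2[of "spatial (boost \<alpha> c s x)" \<alpha>] \<alpha>
      by (simp_all add: u_def v_def)
    then have "u - v \<le> 2 * D" "u + v \<le> 2 * D" by linarith+
    then have le: "q - a \<le> 2 * D / T" "q + a \<le> 2 * D * T"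
      unfolding uv using T by (simp_all add: divide_right_mono)
    have D0: "D \<ge> 0" using \<open>\<bar>u\<bar> \<le> D\<close> by linarith
    have "2 * D / T \<le> 2 * D * T"
      using T D0 by (simp add: divide_le_eq) (smt (verit) mult_left_mono mult_nonneg_nonneg mult_le_cancel_left1)
    with le have "q \<le> 2 * D * T" by linarith
    also have "\<dots> \<le> C * T" using T by (simp add: C_def)
    finally have "q \<le> C * T" .
    moreover have "norm (p /\<^sub>R q) = 1"
    proof -
      have "norm p = q" using pq q0 by (simp add: norm_eq_sqrt_inner)
      then show ?thesis using q0 by simp
    qed
    moreover have "(dist \<alpha> (p /\<^sub>R q))\<^sup>2 \<le> C / (q * T)"
    proof -
      \<comment> \<open>For unit vectors the squared distance is an exact multiple of the small
        quantity \<open>q - a\<close>.\<close>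
      have "(dist \<alpha> (p /\<^sub>R q))\<^sup>2 = 2 * (q - a) / q"
      proof -
        have "(dist \<alpha> (p /\<^sub>R q))\<^sup>2 = (\<alpha> - p /\<^sub>R q) \<bullet> (\<alpha> - p /\<^sub>R q)"
          by (simp only: dist_norm power2_norm_eq_inner)
        also have "\<dots> = \<alpha> \<bullet> \<alpha> - 2 * (p \<bullet> \<alpha>) / q + (p \<bullet> p) / (q * q)"
          by (simp add: inner_diff_left inner_diff_right inner_commute[of \<alpha> p] divide_inverse algebra_simps)
        also have "\<dots> = 2 * (q - a) / q"
          unfolding 1 pq a_def[symmetric] using q0 by (simp add: field_simps)
        finally show ?thesis .
      qed
      also have "\<dots> \<le> 2 * (2 * D / T) / q"
        using le(1) q0 by (intro divide_right_mono mult_left_mono) auto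
      also have "\<dots> \<le> C / (q * T)"
        using q0 T by (simp add: C_def divide_simps)
      finally show ?thesis .
    qed
    ultimately show ?thesis
      using q by (intro exI[of _ p'] exI[of _ "nat m"]) (simp add: rp)
  qed
  moreover have "C \<ge> 1" by (simp add: C_def)
  ultimately show ?thesis by blast
qed

section \<open>Systems of repelling points\<close>

text \<open>This is Cauchy--Schwarz for the counting function \<open>f\<close> of the sets and the
  indicator of their union. It follows by integrating \<open>(t - f x)\<^sup>2\<close> over the
  union for a suitable \<open>t\<close>.\<close>

lemma (in finite_measure) second_moment:
  assumes "finite I" and E: "\<And>i. i \<in> I \<Longrightarrow> E i \<in> sets M"
  shows "(\<Sum>i\<in>I. measure M (E i))\<^sup>2
    \<le> measure M (\<Union>i\<in>I. E i) * (\<Sum>i\<in>I. \<Sum>j\<in>I. measure M (E i \<inter> E j))"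
proof -
  let ?S = "\<Sum>i\<in>I. measure M (E i)" and ?Q = "\<Sum>i\<in>I. \<Sum>j\<in>I. measure M (E i \<inter> E j)"
  let ?u = "measure M (\<Union>i\<in>I. E i)"
  define f where "f x = (\<Sum>i\<in>I. indicator (E i) x :: real)" for x
  have U: "(\<Union>i\<in>I. E i) \<in> sets M" using assms by auto
  have int_ind: "integrable M (indicator A :: _ \<Rightarrow> real)" if "A \<in> sets M" for A
    using that by (intro integrable_real_indicator) (auto simp: emeasure_eq_measure)
  have intf: "integrable M f" "integral\<^sup>L M f = ?S"
    unfolding f_def using E by (auto intro!: Bochner_Integration.integrable_sum int_ind simp: Bochner_Integration.integral_sum int_ind)
  have ff: "f x * f x = (\<Sum>i\<in>I. \<Sum>j\<in>I. indicator (E i \<inter> E j) x)" for x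
    unfolding f_def sum_product by (simp add: indicator_inter_arith)
  have intff: "integrable M (\<lambda>x. f x * f x)" "(\<integral>x. f x * f x \<partial>M) = ?Q"
    unfolding ff using E
    by (auto intro!: Bochner_Integration.integrable_sum int_ind sets.Int simp: Bochner_Integration.integral_sum int_ind sets.Int)
  have key: "2 * t * ?S - ?Q \<le> t\<^sup>2 * ?u" for t
  proof -
    have "2 * t * ?S - ?Q = (\<integral>x. 2 * t * f x - f x * f x \<partial>M)"
      using intf intff by simp
    also have "\<dots> \<le> (\<integral>x. t\<^sup>2 * indicator (\<Union>i\<in>I. E i) x \<partial>M)"
    proof (rule integral_mono)
      show "2 * t * f x - f x * f x \<le> t\<^sup>2 * indicator (\<Union>i\<in>I. E i) x" for x
      proof (cases "x \<in> (\<Union>i\<in>I. E i)")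
        case True
        have "0 \<le> (t - f x)\<^sup>2" by simp
        with True show ?thesis by (simp add: power2_eq_square algebra_simps)
      next
        case False
        then have "f x = 0" by (simp add: f_def)
        with False show ?thesis by simp
      qed
    qed (use intf intff U int_ind in auto)
    also have "\<dots> = t\<^sup>2 * ?u" using U by simp
    finally show ?thesis .
  qed
  show ?thesis
  proof (cases "?S = 0")
    case True
    then show ?thesis by (simp add: sum_nonneg)
  next
    case False
    then have S: "?S > 0" by (simp add: sum_nonneg order_less_le)
    \<comment> \<open>This \<open>t\<close> turns the left-hand side of \<open>key\<close> into the
      second moment itself and requires no division by the measure of the union.\<close>
    from key[of "?Q / ?S"] have "?Q \<le> (?Q / ?S)\<^sup>2 * ?u" using S by simp
    then have le: "?Q * ?S\<^sup>2 \<le> ?Q * (?Q * ?u)"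
      using S by (simp add: power_divide field_simps power2_eq_square)
    have "?Q \<ge> 0" by (simp add: sum_nonneg)
    moreover have "?Q \<noteq> 0"
    proof
      assume "?Q = 0"
      \<comment> \<open>If the second moment vanished, this \<open>t\<close> would give
        \<open>2 * ?S \<le> t * ?u < ?S\<close>. The summand 1 avoids a zero denominator.\<close>
      define t where "t = ?S / (?u + 1)"
      have u: "?u + 1 > 0" using measure_nonneg[of M "\<Union>i\<in>I. E i"] by linarith
      have "t * (2 * ?S) \<le> t * (t * ?u)"
        using key[of t] \<open>?Q = 0\<close> by (simp only: power2_eq_square mult_ac diff_0_right)
      moreover have t: "t > 0" "t * (?u + 1) = ?S" using S u by (auto simp: t_def)
      ultimately have "2 * ?S \<le> t * ?u" by simp
      then show False using t S by (simp add: distrib_left)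
    qed
    ultimately show ?thesis using le by (simp add: mult.commute)
  qed
qed

text \<open>A substitute for the Lebesgue density theorem: by outer regularity some open set around
  a non-null complement exceeds it by less than \<kappa> times its measure, whereas
  \<open>dens\<close> demands at least that much room for \<open>W\<close>.\<close>

lemma null_complement_of_uniform_density:
  fixes M :: "'a :: polish_space measure"
  assumes "finite_measure M" and sb: "sets M = sets borel" and W: "W \<in> sets borel" and \<kappa>: "\<kappa> > 0"
    and dens: "\<And>U. open U \<Longrightarrow> \<kappa> * measure M U \<le> measure M (U \<inter> W)"
  shows "measure M (- W) = 0"
proof (rule ccontr)
  interpret finite_measure M by fact
  assume ne: "measure M (- W) \<noteq> 0"
  let ?m = "measure M (- W)"
  have m: "?m > 0" using ne measure_nonneg[of M "- W"] by linarith
  have cW: "- W \<in> sets borel" using W by auto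
  have "emeasure M (- W) = (INF U \<in> {U. - W \<subseteq> U \<and> open U}. emeasure M U)"
    using outer_regular[OF sb _ cW] by (simp add: emeasure_eq_measure)
  moreover have "emeasure M (- W) < ennreal (?m + \<kappa> * ?m)"
    using m \<kappa> by (simp add: emeasure_eq_measure ennreal_less_iff)
  ultimately obtain U where U: "- W \<subseteq> U" "open U" "emeasure M U < ennreal (?m + \<kappa> * ?m)"
    by (auto simp: INF_less_iff)
  have mU: "measure M U < ?m + \<kappa> * ?m"
    using U(3) m \<kappa> by (simp add: emeasure_eq_measure ennreal_less_iff del: ennreal_plus)
  have "measure M U = measure M (U \<inter> W) + measure M (- W)"
  proof -
    have "U = (U \<inter> W) \<union> - W" using U(1) by auto
    then have "measure M U = measure M ((U \<inter> W) \<union> - W)" by simp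
    also have "\<dots> = measure M (U \<inter> W) + measure M (- W)"
      using W cW U(2) by (intro finite_measure_Union) (auto simp: sb)
    finally show ?thesis .
  qed
  moreover have "?m \<le> measure M U"
    using U W by (intro finite_measure_mono) (auto simp: sb)
  then have "\<kappa> * ?m \<le> measure M (U \<inter> W)"
    using dens[OF U(2)] \<kappa> mult_left_mono[of ?m "measure M U" \<kappa>] by linarith
  ultimately show False using mU by linarith
qed

text \<open>\<open>X\<close> carries an \<open>n\<close>-dimensional measure, and \<open>P k\<close> plays the role of the rational points of
  denominator at most \<open>4 ^ k\<close>: they repel each other at the scale \<open>4 ^ (- k)\<close>, and a theorem of Dirichlet type
  holds. Powers of 4 are used because square roots of denominators occur in the latter.\<close>
locale rational_system =
  fixes M :: "'a::euclidean_space measure" and X :: "'a set" and n D :: nat and c C :: real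
    and P :: "nat \<Rightarrow> 'a set"
  assumes sets_M: "sets M = sets borel"
    and fin_M: "emeasure M (space M) \<noteq> \<infinity>"
    and n_pos: "n \<ge> 1" and c_pos: "c > 0" and C_pos: "C > 0"
    and ball_lower: "\<And>x r. x \<in> X \<Longrightarrow> 0 < r \<Longrightarrow> r \<le> 1 \<Longrightarrow> c * r ^ n \<le> measure M (ball x r)"
    and ball_upper: "\<And>x r. x \<in> X \<Longrightarrow> 0 < r \<Longrightarrow> measure M (ball x r) \<le> C * r ^ n"
    and X_borel: "X \<in> sets borel" and X_full: "measure M (- X) = 0"
    and P_subset: "P k \<subseteq> X"
    and P_mono: "k \<le> l \<Longrightarrow> P k \<subseteq> P l"
    and P_separated: "x \<in> P k \<Longrightarrow> y \<in> P k \<Longrightarrow> x \<noteq> y \<Longrightarrow> 1 / 4 ^ k \<le> dist x y"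
    and P_dirichlet: "\<alpha> \<in> X \<Longrightarrow> \<exists>i x. i \<le> j + D \<and> x \<in> P i \<and> dist \<alpha> x \<le> 2 ^ D / 2 ^ (i + j)"
begin

sublocale finite_measure M
  by standard (rule fin_M)

section \<open>Counting points by packing\<close>

lemma borel_M [simp]: "open U \<Longrightarrow> U \<in> sets M" by (simp add: sets_M)

text \<open>Balls of half the separation are disjoint, and each has measure of order
  \<open>(4 ^ k) ^ (- n)\<close> at least. Finiteness of \<open>F\<close> is assumed because
  \<open>finite_P\<close> is deduced from this bound.\<close>

lemma finite_packing:
  assumes "finite F" "F \<subseteq> P k" "U \<in> sets M" "\<And>x. x \<in> F \<Longrightarrow> ball x (1 / (2 * 4 ^ k)) \<subseteq> U"
  shows "real (card F) \<le> 2 ^ n / c * measure M U * (4 ^ k) ^ n"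
proof -
  let ?r = "1 / (2 * 4 ^ k) :: real"
  have "(1::real) \<le> 4 ^ k" by simp
  then have "(1::real) \<le> 2 * 4 ^ k" by linarith
  then have r: "0 < ?r" "?r \<le> 1" by (simp_all add: divide_le_eq)
  have "real (card F) * (c * ?r ^ n) = (\<Sum>x\<in>F. c * ?r ^ n)" by simp
  also have "\<dots> \<le> (\<Sum>x\<in>F. measure M (ball x ?r))"
    using assms(2) P_subset[of k] r by (intro sum_mono ball_lower) auto
  also have "\<dots> = measure M (\<Union>x\<in>F. ball x ?r)"
  proof (rule finite_measure_finite_Union[symmetric])
    show "disjoint_family_on (\<lambda>x. ball x ?r) F"
      unfolding disjoint_family_on_def
    proof (intro ballI impI)
      fix x y assume "x \<in> F" "y \<in> F" "x \<noteq> y"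
      then have "1 / 4 ^ k \<le> dist x y" using assms(2) by (intro P_separated) auto
      then show "ball x ?r \<inter> ball y ?r = {}" by (intro disjoint_ballI) simp
    qed
  qed (use assms in auto)
  also have "\<dots> \<le> measure M U"
    using assms by (intro finite_measure_mono) auto
  finally show ?thesis using c_pos by (simp add: field_simps power_divide power_mult_distrib)
qed

lemma finite_P: "finite (P k)"
proof (rule ccontr)
  assume inf: "infinite (P k)"
  obtain N :: nat where N: "2 ^ n / c * measure M UNIV * (4 ^ k) ^ n < real N"
    using reals_Archimedean2 by blast
  obtain F where "finite F" "card F = N" "F \<subseteq> P k"
    using infinite_arbitrarily_large[OF inf] by blast
  with finite_packing[of F k UNIV] N show False by simp
qed

lemma packing:
  assumes "F \<subseteq> P k" "U \<in> sets M" "\<And>x. x \<in> F \<Longrightarrow> ball x (1 / (2 * 4 ^ k)) \<subseteq> U"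
  shows "real (card F) \<le> 2 ^ n / c * measure M U * (4 ^ k) ^ n"
  using assms finite_subset[OF assms(1) finite_P] by (intro finite_packing)

text \<open>The convergence half: \<open>P k\<close> has at most a constant times
  \<open>(4 ^ k) ^ n\<close> points, so the measures of the unions are dominated by a multiple of
  the given series, and Borel--Cantelli applies.\<close>

lemma null_limsup:
  assumes r: "\<And>k. r k > 0" and sm: "summable (\<lambda>k. (4 ^ k * r k) ^ n)"
  shows "limsup (\<lambda>k. \<Union>x\<in>P k. ball x (r k)) \<in> null_sets M"
proof (rule borel_cantelli_limsup1)
  let ?K = "2 ^ n / c * measure M UNIV * C"
  show "summable (\<lambda>k. measure M (\<Union>x\<in>P k. ball x (r k)))"
  proof (rule summable_comparison_test')
    show "summable (\<lambda>k. ?K * (4 ^ k * r k) ^ n)" using sm by (rule summable_mult)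
    fix k :: nat
    have "measure M (\<Union>x\<in>P k. ball x (r k)) \<le> (\<Sum>x\<in>P k. measure M (ball x (r k)))"
      by (intro measure_UNION_le finite_P) auto
    also have "\<dots> \<le> (\<Sum>x\<in>P k. C * r k ^ n)"
      using P_subset[of k] r by (intro sum_mono ball_upper) auto
    also have "\<dots> = real (card (P k)) * (C * r k ^ n)" by simp
    also have "\<dots> \<le> (2 ^ n / c * measure M UNIV * (4 ^ k) ^ n) * (C * r k ^ n)"
      using C_pos r[of k] by (intro mult_right_mono packing) auto
    finally show "norm (measure M (\<Union>x\<in>P k. ball x (r k))) \<le> ?K * (4 ^ k * r k) ^ n"
      by (simp add: power_mult_distrib mult_ac)
  qed
qed (auto simp: emeasure_eq_measure intro!: borel_M)

text \<open>The sets \<open>V m\<close> increase to \<open>U\<close>, so one of them has at least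
  half of its measure. The margin \<eta> ensures that points found close to the inner part remain
  well inside \<open>U\<close>.\<close>

lemma inner_part:
  assumes "open U" and U: "measure M U > 0"
  obtains \<eta> where "\<eta> > 0" "measure M {x. ball x \<eta> \<subseteq> U} \<ge> measure M U / 2" "{x. ball x \<eta> \<subseteq> U} \<in> sets M"
proof -
  define V where "V m = {x. ball x (1 / real (Suc m)) \<subseteq> U}" for m
  have cl: "closed {x. ball x r \<subseteq> U}" for r
  proof -
    have "- {x. ball x r \<subseteq> U} = (\<Union>y\<in>-U. ball y r)"
      by (auto simp: dist_commute subset_iff)
    then have "open (- {x. ball x r \<subseteq> U})" by auto
    then show ?thesis by (simp add: closed_def)
  qed
  then have sets: "{x. ball x r \<subseteq> U} \<in> sets M" for r
    by (simp add: sets_M)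
  have inc: "incseq V"
  proof (intro incseq_SucI subsetI)
    fix m x assume "x \<in> V m"
    moreover have "1 / real (Suc (Suc m)) \<le> 1 / real (Suc m)" by (simp add: field_simps)
    ultimately show "x \<in> V (Suc m)" unfolding V_def using subset_ball by blast
  qed
  have "(\<Union>m. V m) = U"
  proof
    show "(\<Union>m. V m) \<subseteq> U"
    proof
      fix x assume "x \<in> (\<Union>m. V m)"
      then obtain m where "ball x (1 / real (Suc m)) \<subseteq> U" by (auto simp: V_def)
      moreover have "x \<in> ball x (1 / real (Suc m))" by simp
      ultimately show "x \<in> U" by blast
    qed
    show "U \<subseteq> (\<Union>m. V m)"
    proof
      fix x assume "x \<in> U"
      then obtain e where e: "e > 0" "ball x e \<subseteq> U" using \<open>open U\<close> open_contains_ball by blast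
      obtain m where "1 / real (Suc m) < e" using nat_approx_posE[OF e(1)] by blast
      then have "x \<in> V m" unfolding V_def using e(2) subset_ball[of "1 / real (Suc m)" e x] by auto
      then show "x \<in> (\<Union>m. V m)" by blast
    qed
  qed
  moreover have "(\<lambda>m. measure M (V m)) \<longlonglongrightarrow> measure M (\<Union>m. V m)"
    by (rule finite_Lim_measure_incseq[OF _ inc]) (auto simp: V_def sets)
  ultimately have "(\<lambda>m. measure M (V m)) \<longlonglongrightarrow> measure M U" by simp
  then have "\<forall>\<^sub>F m in sequentially. measure M (V m) > measure M U / 2"
    using U by (intro order_tendstoD) auto
  then obtain m where m: "measure M (V m) > measure M U / 2"
    using eventually_happens'[OF sequentially_bot] by blast
  show ?thesis
    by (rule that[of "1 / real (Suc m)"]) (use m sets in \<open>auto simp: V_def less_imp_le\<close>)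
qed

text \<open>The points of denominator at most \<open>4 ^ (k - K)\<close> cover at most half of the set that is covered according
  to the theorem of Dirichlet type; therefore there are many points of denominator about \<open>4 ^ k\<close>.\<close>

lemma many_points:
  "\<exists>K \<kappa>. \<kappa> > 0 \<and> (\<forall>U. open U \<longrightarrow> measure M U > 0 \<longrightarrow> (\<exists>\<delta>>0. \<forall>\<^sub>F k in sequentially.
     \<kappa> * measure M U * (4 ^ k) ^ n \<le> real (card {x \<in> P k - P (k - K). ball x \<delta> \<subseteq> U})))"
proof -
  \<comment> \<open>Apart from the levels below \<open>i0\<close>, the coarse levels
    \<open>i \<le> k - K\<close> will turn out to cover at most the proportion
    \<open>L / (2 ^ K) ^ n\<close> of \<open>measure M U\<close>; \<open>K\<close> makes this at
    most 1/8.\<close>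
  define L where "L = 2 ^ n / c * C * (2 ^ (D + 1)) ^ n * 2 * (2 ^ D) ^ n"
  have L: "L > 0" using c_pos C_pos by (simp add: L_def)
  obtain K :: nat where K: "8 * L < 2 ^ K" using real_arch_pow[of 2 "8 * L"] by auto
  \<comment> \<open>The radius \<open>2 ^ (D + 1) / 2 ^ (i + j)\<close> for \<open>i = k - K\<close>
    and \<open>j = k - D\<close>, in units of \<open>4 ^ (- k)\<close>.\<close>
  define \<rho> :: real where "\<rho> = 2 ^ (D + 1) * 2 ^ K * 2 ^ D"
  define \<kappa> where "\<kappa> = 1 / (4 * C * \<rho> ^ n)"
  have \<rho>: "\<rho> > 0" by (simp add: \<rho>_def)
  have "\<exists>\<delta>>0. \<forall>\<^sub>F k in sequentially.
     \<kappa> * measure M U * (4 ^ k) ^ n \<le> real (card {x \<in> P k - P (k - K). ball x \<delta> \<subseteq> U})"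
    if U: "open U" and U0: "measure M U > 0" for U
  proof -
    let ?u = "measure M U"
    obtain \<eta> where \<eta>: "\<eta> > 0" "measure M {x. ball x \<eta> \<subseteq> U} \<ge> ?u / 2" "{x. ball x \<eta> \<subseteq> U} \<in> sets M"
      using inner_part[OF U U0] by blast
    define \<delta> where "\<delta> = \<eta> / 2"
    define V where "V = {x. ball x \<eta> \<subseteq> U}"
    have tend: "(\<lambda>k. (1 / 2 :: real) ^ k) \<longlonglongrightarrow> 0" by (rule LIMSEQ_power_zero) simp
    \<comment> \<open>From level \<open>i0\<close> on, the packing balls around the points counted
      by \<open>N\<close> lie in \<open>U\<close>; below it the crude bound \<open>m\<close> is
      used.\<close>
    obtain i0 where i0: "\<And>i. i \<ge> i0 \<Longrightarrow> 1 / (2 * 4 ^ i) \<le> \<delta>"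
    proof -
      have "(\<lambda>k. (1 / 4 :: real) ^ k) \<longlonglongrightarrow> 0" by (rule LIMSEQ_power_zero) simp
      then have "\<forall>\<^sub>F k in sequentially. (1 / 4) ^ k < \<delta>"
        using \<eta>(1) by (intro order_tendstoD) (auto simp: \<delta>_def)
      then obtain i0 where i0: "\<And>i. i \<ge> i0 \<Longrightarrow> (1 / 4) ^ i < \<delta>" by (auto simp: eventually_sequentially)
      show ?thesis
      proof (rule that[of i0])
        fix i assume "i \<ge> i0"
        have "1 / (2 * 4 ^ i) \<le> (1 / 4 :: real) ^ i" by (simp add: power_divide field_simps)
        with i0[OF \<open>i \<ge> i0\<close>] show "1 / (2 * 4 ^ i) \<le> \<delta>" by simp
      qed
    qed
    define m where "m = real (card (P i0))"
    define N where "N i = real (card {x \<in> P i. ball x \<delta> \<subseteq> U})" for i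
    have N: "N i \<le> 2 ^ n / c * ?u * (4 ^ i) ^ n + (if i < i0 then m else 0)" for i
    proof (cases "i < i0")
      case True
      have "N i \<le> m"
        unfolding N_def m_def using P_mono[of i i0] True
        by (intro of_nat_mono card_mono finite_P) auto
      then show ?thesis using True c_pos by (simp add: add_increasing)
    next
      case False
      have "N i \<le> 2 ^ n / c * ?u * (4 ^ i) ^ n"
        unfolding N_def
      proof (rule packing)
        fix x assume "x \<in> {x \<in> P i. ball x \<delta> \<subseteq> U}"
        then show "ball x (1 / (2 * 4 ^ i)) \<subseteq> U"
          using subset_ball[OF i0[of i], of x] False by auto
      qed (use U in auto)
      then show ?thesis using False by simp
    qed
    define Q where "Q k = {x \<in> P k - P (k - K). ball x \<delta> \<subseteq> U}" for k
    \<comment> \<open>The constant for the levels below \<open>i0\<close>; their contribution is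
      \<open>B / (2 ^ j) ^ n\<close> and becomes negligible.\<close>
    define B where "B = real i0 * m * C * (2 ^ (D + 1)) ^ n"
    have "\<forall>\<^sub>F j in sequentially. (1/2) ^ j < min (\<delta> / 2 ^ D) (?u / (8 * (B + 1)))"
      using tend U0 \<eta>(1) C_pos by (intro order_tendstoD) (auto simp: \<delta>_def B_def m_def add_nonneg_pos)
    then obtain j0 where j0: "\<And>j. j \<ge> j0 \<Longrightarrow> (1/2) ^ j < \<delta> / 2 ^ D"
        "\<And>j. j \<ge> j0 \<Longrightarrow> (1/2) ^ j < ?u / (8 * (B + 1))"
      by (auto simp: eventually_sequentially)
    have "\<kappa> * ?u * (4 ^ k) ^ n \<le> real (card (Q k))" if k: "k \<ge> j0 + D + K" for k
    proof -
      \<comment> \<open>With this \<open>j\<close> the theorem of Dirichlet type yields points of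
        \<open>P k\<close> only.\<close>
      define j where "j = k - D"
      have kj: "k = j + D" "j \<ge> j0" using k by (auto simp: j_def)
      \<comment> \<open>Doubled radii turn the weak inequality of \<open>P_dirichlet\<close> into
        membership in open balls.\<close>
      define F where "F i = (\<Union>x\<in>{x \<in> P i. ball x \<delta> \<subseteq> U}. ball x (2 ^ (D + 1) / 2 ^ (i + j)))" for i
      define G where "G = (\<Union>x\<in>Q k. ball x (\<rho> / 4 ^ k))"
      have "V \<inter> X \<subseteq> G \<union> (\<Union>i\<le>k - K. F i)"
      proof
        fix \<alpha> assume \<alpha>: "\<alpha> \<in> V \<inter> X"
        obtain i x where ix: "i \<le> k" "x \<in> P i" "dist \<alpha> x \<le> 2 ^ D / 2 ^ (i + j)"
          using P_dirichlet[of \<alpha> j] \<alpha> by (auto simp: kj)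
        have "2 ^ D / 2 ^ (i + j) \<le> (2 ^ D / 2 ^ j :: real)"
          by (intro divide_left_mono power_increasing) auto
        also have "\<dots> < \<delta>" using j0(1)[OF kj(2)] by (simp add: power_divide field_simps)
        finally have "dist \<alpha> x < \<delta>" using ix(3) by simp
        have xU: "ball x \<delta> \<subseteq> U"
        proof -
          have "ball x \<delta> \<subseteq> ball \<alpha> \<eta>"
          proof
            fix y assume "y \<in> ball x \<delta>"
            then show "y \<in> ball \<alpha> \<eta>"
              using \<open>dist \<alpha> x < \<delta>\<close> dist_triangle[of \<alpha> y x] by (simp add: \<delta>_def)
          qed
          also have "\<dots> \<subseteq> U" using \<alpha> by (auto simp: V_def)
          finally show ?thesis .
        qed
        show "\<alpha> \<in> G \<union> (\<Union>i\<le>k - K. F i)"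
        proof (cases "x \<in> P (k - K)")
          case True
          \<comment> \<open>The level \<open>i\<close> may exceed \<open>k - K\<close> although
            \<open>x\<close> is already coarse; lowering it only enlarges the ball.\<close>
          define i' where "i' = min i (k - K)"
          have i': "i' \<le> k - K" "i' \<le> i" "x \<in> P i'" using True ix(2) by (auto simp: i'_def min_def)
          have "2 ^ D / 2 ^ (i + j) \<le> (2 ^ D / 2 ^ (i' + j) :: real)"
            using i'(2) by (intro divide_left_mono power_increasing) auto
          also have "\<dots> < 2 ^ (D + 1) / 2 ^ (i' + j)"
            by (intro divide_strict_right_mono) auto
          finally have "\<alpha> \<in> ball x (2 ^ (D + 1) / 2 ^ (i' + j))"
            using ix(3) by (simp add: dist_commute)
          then show ?thesis using i' xU by (auto simp: F_def)
        next
          case False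
          then have "\<not> i \<le> k - K" using P_mono[of i "k - K"] ix(2) by blast
          then have i: "k \<le> i + K" by simp
          have "x \<in> Q k" using False xU ix P_mono[OF ix(1)] by (auto simp: Q_def)
          have "2 ^ D / 2 ^ (i + j) < (2 ^ (D + 1) / 2 ^ (i + j) :: real)"
            by (intro divide_strict_right_mono) auto
          also have "\<dots> = 2 ^ (D + 1) * 2 ^ K * 2 ^ D / 2 ^ (i + K + (j + D))"
            by (simp add: power_add)
          also have "\<dots> \<le> \<rho> / 2 ^ (k + k)"
            unfolding \<rho>_def using i kj by (intro divide_left_mono power_increasing) auto
          also have "(2 :: real) ^ (k + k) = 4 ^ k"
            by (simp add: power_add flip: power_mult_distrib)
          finally have "\<alpha> \<in> ball x (\<rho> / 4 ^ k)"
            using ix(3) by (simp add: dist_commute)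
          then show ?thesis using \<open>x \<in> Q k\<close> by (auto simp: G_def)
        qed
      qed
      have finQ: "finite (Q k)" unfolding Q_def using finite_P[of k] by auto
      have QX: "x \<in> X" if "x \<in> Q k" for x using that P_subset[of k] by (auto simp: Q_def)
      have F_sets: "F i \<in> sets M" for i unfolding F_def by (intro borel_M) auto
      have G_sets: "G \<in> sets M" unfolding G_def by (intro borel_M) auto
      have mG: "measure M G \<le> real (card (Q k)) * (C * (\<rho> / 4 ^ k) ^ n)"
      proof -
        have "measure M G \<le> (\<Sum>x\<in>Q k. measure M (ball x (\<rho> / 4 ^ k)))"
          unfolding G_def by (intro measure_UNION_le finQ) auto
        also have "\<dots> \<le> (\<Sum>x\<in>Q k. C * (\<rho> / 4 ^ k) ^ n)"
          using QX \<rho> by (intro sum_mono ball_upper) auto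
        finally show ?thesis by simp
      qed
      have mF: "measure M (F i) \<le> N i * (C * (2 ^ (D + 1) / 2 ^ (i + j)) ^ n)" for i
      proof -
        have "measure M (F i) \<le> (\<Sum>x\<in>{x \<in> P i. ball x \<delta> \<subseteq> U}. measure M (ball x (2 ^ (D + 1) / 2 ^ (i + j))))"
          unfolding F_def using finite_P[of i] by (intro measure_UNION_le) auto
        also have "\<dots> \<le> (\<Sum>x\<in>{x \<in> P i. ball x \<delta> \<subseteq> U}. C * (2 ^ (D + 1) / 2 ^ (i + j)) ^ n)"
          using P_subset[of i] by (intro sum_mono ball_upper) auto
        finally show ?thesis by (simp add: N_def)
      qed
      define A where "A = C * (2 ^ (D + 1)) ^ n / (2 ^ j) ^ n"
      have A0: "A \<ge> 0" using C_pos by (simp add: A_def)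
      \<comment> \<open>About \<open>(4 ^ i) ^ n\<close> balls of measure about
        \<open>(2 ^ (i + j)) ^ (- n)\<close> give growth by \<open>2 ^ n\<close> per level, so the
        last coarse level dominates the sum.\<close>
      have mF': "measure M (F i) \<le> 2 ^ n / c * ?u * A * (2 ^ n) ^ i + (if i < i0 then m * A else 0)" for i
      proof -
        have "C * (2 ^ (D + 1) / 2 ^ (i + j)) ^ n = A / (2 ^ i) ^ n"
          by (simp add: A_def power_add power_divide power_mult_distrib)
        then have "measure M (F i) \<le> N i * (A / (2 ^ i) ^ n)"
          using mF[of i] by simp
        also have "\<dots> \<le> (2 ^ n / c * ?u * (4 ^ i) ^ n + (if i < i0 then m else 0)) * (A / (2 ^ i) ^ n)"
          using N A0 by (intro mult_right_mono) auto
        also have "\<dots> = 2 ^ n / c * ?u * A * ((4 ^ i) ^ n / (2 ^ i) ^ n) + (if i < i0 then m * (A / (2 ^ i) ^ n) else 0)"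
          by (simp add: algebra_simps)
        also have "(4 ^ i) ^ n / (2 ^ i) ^ n = ((2 ^ n) ^ i :: real)"
          by (simp add: power_divide[symmetric] power_mult[symmetric] mult.commute)
        also have "(if i < i0 then m * (A / (2 ^ i) ^ n) else 0) \<le> (if i < i0 then m * A else 0)"
        proof -
          have "A / (2 ^ i) ^ n \<le> A / 1" using A0 by (intro divide_left_mono) auto
          then have "m * (A / (2 ^ i) ^ n) \<le> m * (A / 1)" by (rule mult_left_mono) (simp add: m_def)
          then show ?thesis by simp
        qed
        finally show ?thesis by simp
      qed
      have geo: "(\<Sum>i\<le>s. (2 ^ n) ^ i) \<le> 2 * ((2 ^ n :: real) ^ s)" for s
      proof (induction s)
        case (Suc s)
        have "(2 :: real) ^ 1 \<le> 2 ^ n" using n_pos by (intro power_increasing) auto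
        then have "2 * (2 ^ n :: real) ^ s \<le> 2 ^ n * (2 ^ n) ^ s" by (intro mult_right_mono) auto
        with Suc show ?case unfolding sum.atMost_Suc power_Suc by linarith
      qed simp
      have "(\<Sum>i\<le>k - K. measure M (F i))
          \<le> (\<Sum>i\<le>k - K. 2 ^ n / c * ?u * A * (2 ^ n) ^ i + (if i < i0 then m * A else 0))"
        by (intro sum_mono mF')
      also have "\<dots> = 2 ^ n / c * ?u * A * (\<Sum>i\<le>k - K. (2 ^ n) ^ i) + (\<Sum>i\<le>k - K. if i < i0 then m * A else 0)"
        by (simp add: sum.distrib sum_distrib_left)
      also have "\<dots> \<le> 2 ^ n / c * ?u * A * (2 * (2 ^ n) ^ (k - K)) + real i0 * (m * A)"
      proof (intro add_mono mult_left_mono geo)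
        have "(\<Sum>i\<le>k - K. if i < i0 then m * A else 0) = (\<Sum>i\<in>{..k - K} \<inter> {..<i0}. m * A)"
          by (subst sum.inter_restrict) (auto intro!: sum.cong)
        also have "\<dots> \<le> (\<Sum>i<i0. m * A)"
          using A0 by (intro sum_mono2) (auto simp: m_def)
        finally show "(\<Sum>i\<le>k - K. if i < i0 then m * A else 0) \<le> real i0 * (m * A)" by simp
      qed (use A0 c_pos in auto)
      also have "2 ^ n / c * ?u * A * (2 * (2 ^ n) ^ (k - K)) \<le> ?u / 8"
      proof -
        have e: "(2 ^ n :: real) ^ (k - K) = (2 ^ j) ^ n * (2 ^ D) ^ n / (2 ^ K) ^ n"
        proof -
          have "(2 ^ n :: real) ^ (k - K) * (2 ^ n) ^ K = (2 ^ n) ^ j * (2 ^ n) ^ D"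
            using k kj(1) by (simp flip: power_add)
          then show ?thesis by (simp add: field_simps power_mult[symmetric] mult.commute)
        qed
        have "2 ^ n / c * ?u * A * (2 * (2 ^ n) ^ (k - K)) = L / (2 ^ K) ^ n * ?u"
          unfolding e A_def L_def by simp
        also have "\<dots> \<le> 1 / 8 * ?u"
        proof (rule mult_right_mono)
          have "(2 ^ K :: real) ^ 1 \<le> (2 ^ K) ^ n" using n_pos by (intro power_increasing) auto
          with K show "L / (2 ^ K) ^ n \<le> 1 / 8" by (simp add: divide_simps)
        qed simp
        finally show ?thesis by simp
      qed
      also have "real i0 * (m * A) \<le> ?u / 8"
      proof -
        have B0: "B \<ge> 0" using C_pos by (simp add: B_def m_def)
        have "real i0 * (m * A) = B / (2 ^ j) ^ n" by (simp add: A_def B_def)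
        also have "\<dots> \<le> B / (2 ^ j) ^ 1"
          using B0 n_pos by (intro divide_left_mono power_increasing) auto
        also have "\<dots> = B * (1/2) ^ j" by (simp add: power_divide)
        also have "\<dots> \<le> B * (?u / (8 * (B + 1)))"
          using j0(2)[OF kj(2)] B0 by (intro mult_left_mono) auto
        also have "\<dots> \<le> ?u / 8" using B0 U0 by (simp add: divide_simps)
        finally show ?thesis .
      qed
      finally have sF: "(\<Sum>i\<le>k - K. measure M (F i)) \<le> ?u / 4" by simp
      \<comment> \<open>At least \<open>?u / 2\<close> is covered, and the coarse levels account for
        at most \<open>?u / 4\<close> of it; \<open>G\<close> must cover the rest.\<close>
      have "?u / 2 \<le> measure M V" using \<eta>(2) by (simp add: V_def)
      also have "\<dots> \<le> measure M ((V \<inter> X) \<union> - X)"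
        using \<eta>(3) X_borel by (intro finite_measure_mono) (auto simp: V_def sets_M)
      also have "\<dots> \<le> measure M (V \<inter> X) + measure M (- X)"
        using \<eta>(3) X_borel by (intro measure_subadditive) (auto simp: V_def sets_M emeasure_eq_measure)
      also have "\<dots> \<le> measure M (G \<union> (\<Union>i\<le>k - K. F i))"
        using X_full \<open>V \<inter> X \<subseteq> _\<close> F_sets G_sets by (simp add: finite_measure_mono)
      also have "\<dots> \<le> measure M G + measure M (\<Union>i\<le>k - K. F i)"
        using F_sets G_sets by (intro measure_subadditive) (auto simp: emeasure_eq_measure)
      also have "\<dots> \<le> real (card (Q k)) * (C * (\<rho> / 4 ^ k) ^ n) + (\<Sum>i\<le>k - K. measure M (F i))"
        using F_sets by (intro add_mono mG measure_UNION_le) auto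
      finally have "?u / 4 \<le> real (card (Q k)) * (C * (\<rho> / 4 ^ k) ^ n)" using sF by simp
      then show ?thesis
        using C_pos \<rho> by (simp add: \<kappa>_def power_divide field_simps)
    qed
    then show ?thesis
      using \<eta>(1) unfolding eventually_sequentially Q_def
      by (intro exI[of _ \<delta>]) (auto simp: \<delta>_def)
  qed
  moreover have "\<kappa> > 0" using C_pos \<rho> by (simp add: \<kappa>_def)
  ultimately show ?thesis by blast
qed

text \<open>Packing in a ball enlarged by half the separation. The summand 1 covers radii below the
  separation scale, for which the power alone would be too small.\<close>

lemma card_near:
  assumes "x \<in> X" "r > 0"
  shows "real (card {y \<in> P l. dist x y < 2 * r}) \<le> 2 ^ n / c * C * ((4 * (4 ^ l * r)) ^ n + 1)"
proof -
  let ?s = "2 * r + 1 / (2 * 4 ^ l)"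
  have s: "?s > 0" using assms(2) by (intro add_pos_pos) auto
  have "real (card {y \<in> P l. dist x y < 2 * r}) \<le> 2 ^ n / c * measure M (ball x ?s) * (4 ^ l) ^ n"
  proof (rule packing)
    fix y assume y: "y \<in> {y \<in> P l. dist x y < 2 * r}"
    show "ball y (1 / (2 * 4 ^ l)) \<subseteq> ball x ?s"
    proof
      fix z assume "z \<in> ball y (1 / (2 * 4 ^ l))"
      then show "z \<in> ball x ?s" using y dist_triangle[of x z y] by auto
    qed
  qed auto
  also have "\<dots> \<le> 2 ^ n / c * (C * ?s ^ n) * (4 ^ l) ^ n"
    using c_pos by (intro mult_right_mono mult_left_mono ball_upper assms s) auto
  also have "\<dots> = 2 ^ n / c * C * (?s * 4 ^ l) ^ n"
    by (simp add: power_mult_distrib)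
  also have "?s * 4 ^ l = 2 * (4 ^ l * r) + 1 / 2"
    by (simp add: field_simps)
  also have "2 ^ n / c * C * (2 * (4 ^ l * r) + 1 / 2) ^ n \<le> 2 ^ n / c * C * ((4 * (4 ^ l * r)) ^ n + 1)"
  proof (rule mult_left_mono)
    show "(2 * (4 ^ l * r) + 1 / 2) ^ n \<le> (4 * (4 ^ l * r)) ^ n + 1"
    proof (cases "2 * (4 ^ l * r) \<le> 1 / 2")
      case True
      then have "(2 * (4 ^ l * r) + 1 / 2) ^ n \<le> 1 ^ n"
        using assms(2) by (intro power_mono) auto
      moreover have "0 \<le> (4 * (4 ^ l * r)) ^ n" using assms(2) by simp
      ultimately show ?thesis by simp
    next
      case False
      then have "2 * (4 ^ l * r) + 1 / 2 \<le> 4 * (4 ^ l * r)" by linarith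
      then have "(2 * (4 ^ l * r) + 1 / 2) ^ n \<le> (4 * (4 ^ l * r)) ^ n"
        using assms(2) by (intro power_mono) auto
      then show ?thesis by simp
    qed
  qed (use c_pos C_pos in auto)
  finally show ?thesis .
qed

text \<open>A ball of the coarser family meets only balls with centres within \<open>2 * r\<close>,
  which \<open>card_near\<close> counts. The first term expresses independence on average; the
  second stems from the summand 1 in \<open>card_near\<close> and decays with the gap
  \<open>l - k\<close>.\<close>

lemma overlap:
  assumes Q: "Q \<subseteq> P k" "real (card Q) \<le> A * (4 ^ k) ^ n" and R: "R \<subseteq> P l" and "A \<ge> 0"
    and kl: "k \<le> l" and r: "0 < s" "s \<le> r"
  shows "measure M ((\<Union>x\<in>Q. ball x r) \<inter> (\<Union>y\<in>R. ball y s)) \<le>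
    A * (2 ^ n / c * C * C * 4 ^ n) * ((4 ^ k * r) ^ n * (4 ^ l * s) ^ n + (4 ^ l * s) ^ n * (1/4) ^ (l - k))"
proof -
  have fin: "finite Q" using finite_subset[OF Q(1) finite_P] .
  define near where "near x = {y \<in> P l. dist x y < 2 * r}" for x
  have fn: "finite (near x)" for x unfolding near_def using finite_P[of l] by auto
  let ?N = "2 ^ n / c * C * ((4 * (4 ^ l * r)) ^ n + 1)"
  have "(\<Union>x\<in>Q. ball x r) \<inter> (\<Union>y\<in>R. ball y s) \<subseteq> (\<Union>x\<in>Q. \<Union>y\<in>near x. ball y s)"
  proof
    fix z assume "z \<in> (\<Union>x\<in>Q. ball x r) \<inter> (\<Union>y\<in>R. ball y s)"
    then obtain x y where xy: "x \<in> Q" "y \<in> R" "dist x z < r" "dist y z < s" by auto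
    then have "dist x y < 2 * r" using r dist_triangle2[of x y z] by linarith
    then show "z \<in> (\<Union>x\<in>Q. \<Union>y\<in>near x. ball y s)" using xy R by (auto simp: near_def)
  qed
  then have "measure M ((\<Union>x\<in>Q. ball x r) \<inter> (\<Union>y\<in>R. ball y s)) \<le> measure M (\<Union>x\<in>Q. \<Union>y\<in>near x. ball y s)"
    by (intro finite_measure_mono borel_M) auto
  also have "\<dots> \<le> (\<Sum>x\<in>Q. measure M (\<Union>y\<in>near x. ball y s))"
    by (intro measure_UNION_le fin borel_M) auto
  also have "\<dots> \<le> (\<Sum>x\<in>Q. ?N * (C * s ^ n))"
  proof (rule sum_mono)
    fix x assume "x \<in> Q"
    then have x: "x \<in> X" using Q P_subset[of k] by auto
    have "measure M (\<Union>y\<in>near x. ball y s) \<le> (\<Sum>y\<in>near x. measure M (ball y s))"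
      by (intro measure_UNION_le fn) auto
    also have "\<dots> \<le> (\<Sum>y\<in>near x. C * s ^ n)"
      using P_subset[of l] r by (intro sum_mono ball_upper) (auto simp: near_def)
    also have "\<dots> = real (card (near x)) * (C * s ^ n)" by simp
    also have "\<dots> \<le> ?N * (C * s ^ n)"
      using x r C_pos unfolding near_def by (intro mult_right_mono card_near) auto
    finally show "measure M (\<Union>y\<in>near x. ball y s) \<le> ?N * (C * s ^ n)" .
  qed
  also have "\<dots> = real (card Q) * (?N * (C * s ^ n))" by simp
  also have "\<dots> \<le> A * (4 ^ k) ^ n * (?N * (C * s ^ n))"
    using Q(2) c_pos C_pos r by (intro mult_right_mono mult_nonneg_nonneg) auto
  also have "\<dots> = A * (2 ^ n / c * C * C) * (4 ^ n * ((4 ^ k * r) ^ n * (4 ^ l * s) ^ n) + (4 ^ k * s) ^ n)"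
    by (simp add: power_mult_distrib algebra_simps)
  also have "\<dots> \<le> A * (2 ^ n / c * C * C) * (4 ^ n * ((4 ^ k * r) ^ n * (4 ^ l * s) ^ n) + 4 ^ n * ((4 ^ l * s) ^ n * (1/4) ^ (l - k)))"
  proof (intro mult_left_mono add_left_mono)
    have l: "(4 :: real) ^ l = 4 ^ k * 4 ^ (l - k)" using kl by (simp flip: power_add)
    have "4 ^ k * s = 4 ^ l * s * (1/4) ^ (l - k)"
      unfolding l by (simp add: power_divide)
    then have "(4 ^ k * s) ^ n = (4 ^ l * s) ^ n * ((1/4) ^ (l - k)) ^ n"
      by (simp only: power_mult_distrib)
    also have "\<dots> \<le> (4 ^ l * s) ^ n * ((1/4) ^ (l - k)) ^ 1"
      using n_pos r by (intro mult_left_mono power_decreasing) (auto simp: power_le_one)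
    also have "\<dots> = 1 * ((4 ^ l * s) ^ n * (1/4) ^ (l - k))" by simp
    also have "\<dots> \<le> 4 ^ n * ((4 ^ l * s) ^ n * (1/4) ^ (l - k))"
      using r by (intro mult_right_mono) auto
    finally show "(4 ^ k * s) ^ n \<le> 4 ^ n * ((4 ^ l * s) ^ n * (1/4) ^ (l - k))" .
  qed (use \<open>A \<ge> 0\<close> c_pos C_pos in auto)
  also have "\<dots> = A * (2 ^ n / c * C * C * 4 ^ n) * ((4 ^ k * r) ^ n * (4 ^ l * s) ^ n + (4 ^ l * s) ^ n * (1/4) ^ (l - k))"
    by (simp add: algebra_simps)
  finally show ?thesis .
qed

lemma geometric_weights: "(\<Sum>k\<le>l. (1/4 :: real) ^ (l - k)) \<le> 2"
proof (induction l)
  case (Suc l)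
  have "(\<Sum>k\<le>l. (1/4 :: real) ^ (Suc l - k)) = (\<Sum>k\<le>l. (1/4) ^ (l - k)) / 4"
    by (simp add: sum_divide_distrib Suc_diff_le)
  with Suc show ?case by simp
qed simp

text \<open>The divergence half. Inside an open \<open>U\<close>, \<open>many_points\<close> bounds
  the first moment from below and \<open>overlap\<close> the second from above, so by
  \<open>second_moment\<close> every tail union \<open>W m\<close> fills at least the proportion
  \<open>\<kappa>'\<close> of \<open>U\<close>. Discarding \<open>P (k - K)\<close> keeps the
  denominators large.\<close>

lemma full_limsup:
  fixes \<psi> :: "nat \<Rightarrow> real"
  assumes pos: "\<And>k. \<psi> k > 0" and dec: "decseq (\<lambda>k. 4 ^ k * \<psi> k)" and small: "\<And>k. 4 ^ k * \<psi> k \<le> 1 / 2"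
    and div: "\<not> summable (\<lambda>k. (4 ^ k * \<psi> k) ^ n)"
  shows "\<exists>K. measure M (- (\<Inter>m. \<Union>k\<in>{m..}. \<Union>x\<in>P k - P (k - K). ball x (\<psi> k))) = 0"
proof -
  obtain K \<kappa> where \<kappa>: "\<kappa> > 0" and many: "\<And>U. open U \<Longrightarrow> measure M U > 0 \<Longrightarrow> (\<exists>\<delta>>0. \<forall>\<^sub>F k in sequentially.
     \<kappa> * measure M U * (4 ^ k) ^ n \<le> real (card {x \<in> P k - P (k - K). ball x \<delta> \<subseteq> U}))"
    using many_points by blast
  define b where "b k = (4 ^ k * \<psi> k) ^ n" for k
  have b0: "b k \<ge> 0" for k using pos[of k] by (simp add: b_def)
  define K2 where "K2 = 2 ^ n / c * (2 ^ n / c * C * C * 4 ^ n)"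
  have K2: "K2 > 0" using c_pos C_pos by (simp add: K2_def)
  \<comment> \<open>For an open set of measure \<open>u\<close>, the ratio of
    \<open>(\<kappa> * c * u * S)\<^sup>2\<close> to the bound
    \<open>K2 * u * (5 * S\<^sup>2)\<close> of the second moment is
    \<open>\<kappa>' * u\<close>.\<close>
  define \<kappa>' where "\<kappa>' = (\<kappa> * c)\<^sup>2 / (5 * K2)"
  have \<kappa>': "\<kappa>' > 0" using \<kappa> c_pos K2 by (simp add: \<kappa>'_def)
  define W where "W m = (\<Union>k\<in>{m..}. \<Union>x\<in>P k - P (k - K). ball x (\<psi> k))" for m
  have W_open: "open (W m)" for m unfolding W_def by auto
  have psi_dec: "\<psi> l \<le> \<psi> k" if "k \<le> l" for k l
  proof -
    have "4 ^ l * \<psi> l \<le> 4 ^ k * \<psi> k" using dec that by (simp add: decseq_def)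
    also have "\<dots> \<le> 4 ^ l * \<psi> k" using that pos[of k] by (intro mult_right_mono power_increasing) auto
    finally show ?thesis by simp
  qed
  have psi_small: "\<psi> k \<le> 1 / (2 * 4 ^ k)" for k
    using small[of k] by (simp add: field_simps)
  have tail: "\<kappa>' * measure M U \<le> measure M (U \<inter> W m)" if U: "open U" and u: "measure M U > 0" for U m
  proof -
    let ?u = "measure M U"
    obtain \<delta> where \<delta>: "\<delta> > 0" and ev: "\<forall>\<^sub>F k in sequentially.
       \<kappa> * ?u * (4 ^ k) ^ n \<le> real (card {x \<in> P k - P (k - K). ball x \<delta> \<subseteq> U})"
      using many[OF U u] by blast
    have "(\<lambda>k. (1 / 4 :: real) ^ k) \<longlonglongrightarrow> 0" by (rule LIMSEQ_power_zero) simp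
    then have "\<forall>\<^sub>F k in sequentially. (1 / 4) ^ k < \<delta>" using \<delta> by (intro order_tendstoD) auto
    with ev have "\<forall>\<^sub>F k in sequentially. (1 / 4) ^ k < \<delta> \<and>
       \<kappa> * ?u * (4 ^ k) ^ n \<le> real (card {x \<in> P k - P (k - K). ball x \<delta> \<subseteq> U})"
      by eventually_elim auto
    then obtain k0 where k0: "\<And>k. k \<ge> k0 \<Longrightarrow> (1 / 4) ^ k < \<delta>"
       "\<And>k. k \<ge> k0 \<Longrightarrow> \<kappa> * ?u * (4 ^ k) ^ n \<le> real (card {x \<in> P k - P (k - K). ball x \<delta> \<subseteq> U})"
      by (auto simp: eventually_sequentially)
    have d: "1 / (2 * 4 ^ k) \<le> \<delta>" if "k \<ge> k0" for k
    proof -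
      have "1 / (2 * 4 ^ k) \<le> (1 / 4 :: real) ^ k" by (simp add: power_divide field_simps)
      with k0(1)[OF that] show ?thesis by simp
    qed
    define m' where "m' = max m k0"
    define Q where "Q k = {x \<in> P k - P (k - K). ball x \<delta> \<subseteq> U}" for k
    define E where "E k = (\<Union>x\<in>Q k. ball x (\<psi> k))" for k
    have QP: "Q k \<subseteq> P k" for k by (auto simp: Q_def)
    have finQ: "finite (Q k)" for k using finite_subset[OF QP finite_P] .
    have QX: "x \<in> Q k \<Longrightarrow> x \<in> X" for x k using QP[of k] P_subset[of k] by auto
    have E_sets: "E k \<in> sets M" for k unfolding E_def by (intro borel_M) auto
    have cardQ: "real (card (Q k)) \<le> 2 ^ n / c * ?u * (4 ^ k) ^ n" if "k \<ge> k0" for k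
    proof (rule packing[OF QP])
      fix x assume "x \<in> Q k"
      then show "ball x (1 / (2 * 4 ^ k)) \<subseteq> U"
        using subset_ball[OF d[OF that], of x] by (auto simp: Q_def)
    qed (use U in auto)
    have E_sub: "E k \<subseteq> U" if "k \<ge> k0" for k
    proof
      fix z assume "z \<in> E k"
      then obtain x where x: "x \<in> Q k" "z \<in> ball x (\<psi> k)" by (auto simp: E_def)
      have "\<psi> k \<le> \<delta>" using psi_small[of k] d[OF that] by linarith
      then show "z \<in> U" using x subset_ball[of "\<psi> k" \<delta> x] by (auto simp: Q_def)
    qed
    have E_W: "E k \<subseteq> W m" if "k \<ge> m" for k
      using that by (auto simp: E_def W_def Q_def)
    have E_lower: "\<kappa> * c * ?u * b k \<le> measure M (E k)" if "k \<ge> k0" for k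
    proof -
      have r1: "\<psi> k \<le> 1"
      proof -
        have "(1::real) \<le> 4 ^ k" by simp
        then have "(1::real) \<le> 2 * 4 ^ k" by linarith
        then have "1 / (2 * 4 ^ k) \<le> (1::real)" by (simp add: divide_le_eq)
        with psi_small[of k] show ?thesis by linarith
      qed
      have "\<kappa> * c * ?u * b k = (\<kappa> * ?u * (4 ^ k) ^ n) * (c * \<psi> k ^ n)"
        by (simp add: b_def power_mult_distrib)
      also have "\<dots> \<le> real (card (Q k)) * (c * \<psi> k ^ n)"
        using k0(2)[OF that] c_pos pos[of k] by (intro mult_right_mono) (auto simp: Q_def)
      also have "\<dots> = (\<Sum>x\<in>Q k. c * \<psi> k ^ n)" by simp
      also have "\<dots> \<le> (\<Sum>x\<in>Q k. measure M (ball x (\<psi> k)))"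
        using QX pos r1 by (intro sum_mono ball_lower) auto
      also have "\<dots> = measure M (E k)"
        unfolding E_def
      proof (rule finite_measure_finite_Union[symmetric, OF finQ])
        show "disjoint_family_on (\<lambda>x. ball x (\<psi> k)) (Q k)"
          unfolding disjoint_family_on_def
        proof (intro ballI impI)
          fix x y assume "x \<in> Q k" "y \<in> Q k" "x \<noteq> y"
          then have "1 / 4 ^ k \<le> dist x y" using QP by (intro P_separated) auto
          then show "ball x (\<psi> k) \<inter> ball y (\<psi> k) = {}"
            using psi_small[of k] by (intro disjoint_ballI) simp
        qed
      qed auto
      finally show ?thesis .
    qed
    \<comment> \<open>This vanishes for \<open>k > l\<close>, so \<open>w k l + w l k\<close> bounds
      the error for either order of the two levels.\<close>
    define w where "w k l = (if k \<le> l then b l * (1/4) ^ (l - k) else 0)" for k l :: nat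
    have w0: "w k l \<ge> 0" for k l using b0 by (simp add: w_def)
    have E_overlap: "measure M (E k \<inter> E l) \<le> K2 * ?u * (b k * b l + w k l + w l k)" if "k \<ge> k0" "l \<ge> k0" for k l
    proof -
      have le: "measure M (E k \<inter> E l) \<le> K2 * ?u * (b k * b l + w k l)" if "k \<ge> k0" "k \<le> l" for k l
        using overlap[OF QP cardQ[OF that(1)] QP _ that(2) pos psi_dec[OF that(2)]] c_pos that
        by (simp add: E_def b_def w_def K2_def mult_ac)
      have "b k * b l + w k l \<le> b k * b l + w k l + w l k" "b l * b k + w l k \<le> b k * b l + w k l + w l k"
        using w0 by (auto simp: mult.commute)
      then have mon: "K2 * ?u * (b k * b l + w k l) \<le> K2 * ?u * (b k * b l + w k l + w l k)"
        "K2 * ?u * (b l * b k + w l k) \<le> K2 * ?u * (b k * b l + w k l + w l k)"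
        using K2 by (auto intro!: mult_left_mono)
      show ?thesis
      proof (cases "k \<le> l")
        case True
        then show ?thesis using le[OF that(1) True] mon(1) by linarith
      next
        case False
        then show ?thesis using le[OF that(2), of k] mon(2) by (simp add: Int_commute)
      qed
    qed
    \<comment> \<open>Divergence yields a finite block of levels of total weight at least 1, which
      allows the linear error terms to be absorbed into \<open>S\<^sup>2\<close>.\<close>
    have "\<exists>N. (\<Sum>i<N. b (i + m')) \<ge> 1"
    proof (rule ccontr)
      assume "\<not> ?thesis"
      then have "summable (\<lambda>i. b (i + m'))"
        by (intro summableI_nonneg_bounded[where x = 1]) (auto simp: b0 not_le less_imp_le)
      then have "summable b" by (simp add: summable_iff_shift)
      with div show False by (simp add: b_def[abs_def])
    qed
    then obtain N where N: "(\<Sum>i<N. b (i + m')) \<ge> 1" by blast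
    define I where "I = (\<lambda>i. i + m') ` {..<N}"
    define S where "S = (\<Sum>k\<in>I. b k)"
    have S: "S \<ge> 1" using N by (simp add: S_def I_def sum.reindex)
    have I: "finite I" "\<And>k. k \<in> I \<Longrightarrow> k \<ge> k0" "\<And>k. k \<in> I \<Longrightarrow> k \<ge> m"
      by (auto simp: I_def m'_def)
    have wsum: "(\<Sum>k\<in>I. \<Sum>l\<in>I. w k l) \<le> 2 * S"
    proof -
      have "(\<Sum>k\<in>I. \<Sum>l\<in>I. w k l) = (\<Sum>l\<in>I. \<Sum>k\<in>I. w k l)" by (rule sum.swap)
      also have "\<dots> \<le> (\<Sum>l\<in>I. 2 * b l)"
      proof (rule sum_mono)
        fix l
        have "(\<Sum>k\<in>I. w k l) = (\<Sum>k\<in>I \<inter> {..l}. b l * (1/4) ^ (l - k))"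
          unfolding w_def by (subst sum.inter_restrict[OF I(1)]) (auto intro!: sum.cong)
        also have "\<dots> \<le> (\<Sum>k\<le>l. b l * (1/4) ^ (l - k))"
          by (rule sum_mono2) (auto simp: b0)
        also have "\<dots> = b l * (\<Sum>k\<le>l. (1/4) ^ (l - k))" by (simp add: sum_distrib_left)
        also have "\<dots> \<le> b l * 2" by (intro mult_left_mono geometric_weights b0)
        finally show "(\<Sum>k\<in>I. w k l) \<le> 2 * b l" by simp
      qed
      finally show ?thesis by (simp add: S_def sum_distrib_left)
    qed
    have "(\<Sum>k\<in>I. \<Sum>l\<in>I. measure M (E k \<inter> E l)) \<le> (\<Sum>k\<in>I. \<Sum>l\<in>I. K2 * ?u * (b k * b l + w k l + w l k))"
      by (intro sum_mono E_overlap I)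
    also have "\<dots> = K2 * ?u * (\<Sum>k\<in>I. \<Sum>l\<in>I. b k * b l + w k l + w l k)"
      by (simp add: sum_distrib_left)
    also have "(\<Sum>k\<in>I. \<Sum>l\<in>I. b k * b l + w k l + w l k) = S * S + (\<Sum>k\<in>I. \<Sum>l\<in>I. w k l) + (\<Sum>k\<in>I. \<Sum>l\<in>I. w l k)"
      by (simp add: sum.distrib S_def sum_product)
    also have "(\<Sum>k\<in>I. \<Sum>l\<in>I. w l k) = (\<Sum>k\<in>I. \<Sum>l\<in>I. w k l)" by (rule sum.swap)
    also have "K2 * ?u * (S * S + (\<Sum>k\<in>I. \<Sum>l\<in>I. w k l) + (\<Sum>k\<in>I. \<Sum>l\<in>I. w k l)) \<le> K2 * ?u * (5 * S\<^sup>2)"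
    proof (rule mult_left_mono)
      have "S * 1 \<le> S * S" using S by (intro mult_left_mono) auto
      with wsum show "S * S + (\<Sum>k\<in>I. \<Sum>l\<in>I. w k l) + (\<Sum>k\<in>I. \<Sum>l\<in>I. w k l) \<le> 5 * S\<^sup>2"
        by (simp add: power2_eq_square)
    qed (use K2 in auto)
    finally have S2: "(\<Sum>k\<in>I. \<Sum>l\<in>I. measure M (E k \<inter> E l)) \<le> K2 * ?u * (5 * S\<^sup>2)" .
    have "\<kappa> * c * ?u * S \<le> (\<Sum>k\<in>I. measure M (E k))"
      unfolding S_def sum_distrib_left by (intro sum_mono E_lower I)
    then have "(\<kappa> * c * ?u * S)\<^sup>2 \<le> (\<Sum>k\<in>I. measure M (E k))\<^sup>2"
      using \<kappa> c_pos S by (intro power_mono) auto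
    also have "\<dots> \<le> measure M (\<Union>k\<in>I. E k) * (\<Sum>k\<in>I. \<Sum>l\<in>I. measure M (E k \<inter> E l))"
      by (intro second_moment I E_sets)
    also have "\<dots> \<le> measure M (U \<inter> W m) * (K2 * ?u * (5 * S\<^sup>2))"
    proof (intro mult_mono S2 finite_measure_mono)
      show "(\<Union>k\<in>I. E k) \<subseteq> U \<inter> W m" using E_sub E_W I by blast
      show "U \<inter> W m \<in> sets M" using U W_open by (intro sets.Int) auto
    qed (auto intro!: sum_nonneg)
    finally have "(\<kappa> * c)\<^sup>2 * ?u * (?u * S\<^sup>2) \<le> (measure M (U \<inter> W m) * (5 * K2)) * (?u * S\<^sup>2)"
      by (simp add: power2_eq_square mult_ac)
    moreover have "?u * S\<^sup>2 > 0" using u S by simp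
    ultimately have "(\<kappa> * c)\<^sup>2 * ?u \<le> measure M (U \<inter> W m) * (5 * K2)"
      using mult_le_cancel_right_pos by blast
    then show ?thesis using K2 by (simp add: \<kappa>'_def field_simps)
  qed
  have "measure M (- (\<Inter>m. W m)) = 0"
  proof (rule null_complement_of_uniform_density[OF finite_measure_axioms sets_M _ \<kappa>'])
    show "(\<Inter>m. W m) \<in> sets borel" using W_open by auto
    fix U :: "'a set" assume U: "open U"
    show "\<kappa>' * measure M U \<le> measure M (U \<inter> (\<Inter>m. W m))"
    proof (cases "measure M U > 0")
      case True
      \<comment> \<open>\<open>W m\<close> decreases with \<open>m\<close>, so the bound, being
        uniform in \<open>m\<close>, passes to the intersection.\<close>
      have "decseq (\<lambda>m. U \<inter> W m)"
        unfolding decseq_def W_def by fastforce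
      then have "(\<lambda>m. measure M (U \<inter> W m)) \<longlonglongrightarrow> measure M (\<Inter>m. U \<inter> W m)"
        using U W_open by (intro finite_Lim_measure_decseq) auto
      then have "\<kappa>' * measure M U \<le> measure M (\<Inter>m. U \<inter> W m)"
        using tail[OF U True] by (intro LIMSEQ_le_const) auto
      then show ?thesis by simp
    next
      case False
      then have "measure M U = 0" using measure_nonneg[of M U] by linarith
      then show ?thesis by simp
    qed
  qed
  then show ?thesis unfolding W_def by blast
qed

end

section \<open>The surface measure of balls\<close>

text \<open>The surface measure up to the factor \<open>DIM('a)\<close>, as a Borel measure on the whole space.\<close>
definition cone_measure :: "'a::euclidean_space measure" where
  "cone_measure = distr (restrict_space lborel (ball 0 1 - {0})) borel (\<lambda>x. x /\<^sub>R norm x)"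

lemma measurable_normalize:
  "(\<lambda>x. x /\<^sub>R norm x) \<in> measurable (restrict_space lborel (ball 0 1 - {0})) (borel :: 'a::euclidean_space measure)"
  by (rule measurable_restrict_space1) measurable

lemma sets_cone_measure [simp]: "sets cone_measure = sets borel"
  by (simp add: cone_measure_def)

lemma emeasure_cone_measure:
  fixes A :: "'a::euclidean_space set"
  assumes "A \<in> sets borel"
  shows "emeasure cone_measure A = emeasure lborel {y \<in> ball 0 1 - {0}. y /\<^sub>R norm y \<in> A}"
    and "{y \<in> ball 0 1 - {0}. y /\<^sub>R norm y \<in> A} \<in> sets borel"
proof -
  let ?R = "restrict_space lborel (ball 0 1 - {0 :: 'a})"
  have eq: "(\<lambda>x. x /\<^sub>R norm x) -` A \<inter> space ?R = {y \<in> ball 0 1 - {0}. y /\<^sub>R norm y \<in> A}"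
    by (auto simp: space_restrict_space)
  have "(\<lambda>x. x /\<^sub>R norm x) -` A \<inter> space ?R \<in> sets ?R"
    by (rule measurable_sets[OF measurable_normalize assms])
  then have "{y \<in> ball 0 1 - {0}. y /\<^sub>R norm y \<in> A} \<in> sets ?R" unfolding eq .
  then show "{y \<in> ball 0 1 - {0}. y /\<^sub>R norm y \<in> A} \<in> sets borel"
    by (subst (asm) sets_restrict_space_iff) auto
  have "emeasure cone_measure A = emeasure ?R {y \<in> ball 0 1 - {0}. y /\<^sub>R norm y \<in> A}"
    unfolding cone_measure_def by (subst emeasure_distr[OF measurable_normalize assms]) (simp only: eq)
  also have "\<dots> = emeasure lborel {y \<in> ball 0 1 - {0}. y /\<^sub>R norm y \<in> A}"
    by (rule emeasure_restrict_space) auto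
  finally show "emeasure cone_measure A = emeasure lborel {y \<in> ball 0 1 - {0}. y /\<^sub>R norm y \<in> A}" .
qed

lemma measure_cone_measure:
  "A \<in> sets borel \<Longrightarrow> measure cone_measure A = measure lborel {y \<in> ball 0 1 - {0}. y /\<^sub>R norm y \<in> A}"
  by (simp add: measure_def emeasure_cone_measure)

lemma emeasure_cone_measure_UNIV: "emeasure (cone_measure :: 'a::euclidean_space measure) UNIV \<le> emeasure lborel (ball (0::'a) 1)"
  by (subst emeasure_cone_measure) (auto intro!: emeasure_mono)

lemma finite_measure_cone_measure: "finite_measure (cone_measure :: 'a::euclidean_space measure)"
proof
  have "emeasure (cone_measure :: 'a measure) UNIV < \<infinity>"
    using emeasure_cone_measure_UNIV emeasure_lborel_ball_finite by (rule le_less_trans)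
  then show "emeasure (cone_measure :: 'a measure) (space cone_measure) \<noteq> \<infinity>"
    by (simp add: cone_measure_def)
qed

text \<open>This transfers null sets from the Borel measure \<open>cone_measure\<close> to the
  completed surface measure; \<open>A\<close> itself may fail to be Borel.\<close>

lemma null_sets_sphere_surface:
  fixes A :: "'a::euclidean_space set"
  assumes A: "A \<subseteq> sphere 0 1" "A \<subseteq> B" and B: "B \<in> sets borel" "measure cone_measure B = 0"
  shows "A \<in> null_sets sphere_surface"
proof -
  let ?R = "restrict_space lborel (ball 0 1 - {0 :: 'a})"
  let ?S = "restrict_space borel (sphere 0 1 :: 'a set)"
  let ?D = "distr ?R ?S (\<lambda>x. x /\<^sub>R norm x)"
  interpret finite_measure "cone_measure :: 'a measure" by (rule finite_measure_cone_measure)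
  have BS: "B \<inter> sphere 0 1 \<in> sets ?S"
    using B(1) by (auto simp: sets_restrict_space)
  have "emeasure ?D (B \<inter> sphere 0 1) = emeasure ?R ((\<lambda>x. x /\<^sub>R norm x) -` (B \<inter> sphere 0 1) \<inter> space ?R)"
    by (rule emeasure_distr[OF measurable_radial_projection BS])
  also have "(\<lambda>x. x /\<^sub>R norm x) -` (B \<inter> sphere 0 1) \<inter> space ?R = (\<lambda>x. x /\<^sub>R norm x) -` B \<inter> space ?R"
    by (auto simp: space_restrict_space)
  also have "emeasure ?R \<dots> = emeasure cone_measure B"
    unfolding cone_measure_def by (rule emeasure_distr[OF measurable_normalize B(1), symmetric])
  also have "\<dots> = 0" using B(2) by (simp add: emeasure_eq_measure)
  finally have "B \<inter> sphere 0 1 \<in> null_sets (scale_measure (of_nat DIM('a)) ?D)"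
    using BS by (simp add: null_sets_def)
  then show ?thesis
    unfolding sphere_surface_def null_sets_completion_iff2 using A by blast
qed

text \<open>The cone over the sphere is the punctured unit ball, which contains a ball of positive
  volume. This makes the two alternatives of the theorem exclusive.\<close>

lemma sphere_not_null: "sphere (0 :: 'a::euclidean_space) 1 \<notin> null_sets sphere_surface"
proof
  assume "sphere (0 :: 'a) 1 \<in> null_sets sphere_surface"
  then have "emeasure sphere_surface (sphere (0 :: 'a) 1) = 0" by auto
  moreover obtain b :: 'a where b: "b \<in> Basis" using nonempty_Basis by blast
  have "ball ((1/2) *\<^sub>R b) (1/4) \<subseteq> {t *\<^sub>R a |t a. 0 < t \<and> t < 1 \<and> a \<in> sphere 0 1}"
  proof
    fix y assume "y \<in> ball ((1/2) *\<^sub>R b) (1/4)"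
    then have "norm (y - (1/2) *\<^sub>R b) < 1/4" by (simp add: dist_norm norm_minus_commute)
    moreover have "norm ((1/2) *\<^sub>R b) = 1/2" using b by simp
    ultimately have "norm y < 1" "norm y > 0"
      using norm_triangle_ineq2[of y "(1/2) *\<^sub>R b"] norm_triangle_ineq3[of y "(1/2) *\<^sub>R b"] by linarith+
    then have "y = norm y *\<^sub>R (y /\<^sub>R norm y)" "y /\<^sub>R norm y \<in> sphere 0 1" by auto
    with \<open>norm y < 1\<close> \<open>norm y > 0\<close> show "y \<in> {t *\<^sub>R a |t a. 0 < t \<and> t < 1 \<and> a \<in> sphere 0 1}" by blast
  qed
  moreover have eq: "{t *\<^sub>R a |t a. 0 < t \<and> t < 1 \<and> a \<in> sphere (0::'a) 1} = ball 0 1 - {0}"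
  proof (intro equalityI subsetI)
    fix y :: 'a assume "y \<in> ball 0 1 - {0}"
    then have "y = norm y *\<^sub>R (y /\<^sub>R norm y)" "y /\<^sub>R norm y \<in> sphere 0 1" "0 < norm y" "norm y < 1" by auto
    then show "y \<in> {t *\<^sub>R a |t a. 0 < t \<and> t < 1 \<and> a \<in> sphere 0 1}" by blast
  qed auto
  ultimately have "emeasure lborel (ball ((1/2) *\<^sub>R b) (1/4)) \<le> emeasure lborel (ball (0::'a) 1 - {0})"
    by (intro emeasure_mono) auto
  moreover have "emeasure sphere_surface (sphere (0 :: 'a) 1) = of_nat DIM('a) * emeasure lborel (ball (0::'a) 1 - {0})"
    by (subst emeasure_sphere_surface) (auto simp: eq[simplified])
  ultimately have "emeasure lborel (ball ((1/2) *\<^sub>R b) (1/4)) = 0"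
    using \<open>emeasure sphere_surface (sphere (0 :: 'a) 1) = 0\<close> by simp
  then have "measure lborel (ball ((1/2) *\<^sub>R b) (1/4)) = 0" by (simp add: measure_def)
  then show False by simp
qed

text \<open>The cone over the cap is covered by about \<open>1 / r\<close> balls of radius
  \<open>2 * r\<close> with centres on the segment from 0 to \<open>x\<close>, each of volume of
  order \<open>r ^ (n + 1)\<close>. For \<open>r \<ge> 1\<close> the volume of the unit ball
  suffices.\<close>

lemma cone_measure_ball_upper:
  fixes x :: "'a::euclidean_space"
  assumes x: "norm x = 1" and r: "r > 0" and dim: "DIM('a) = n + 1"
  shows "measure cone_measure (ball x r) \<le> unit_ball_vol (real DIM('a)) * 2 ^ (n + 2) * r ^ n"
proof (cases "r \<ge> 1")
  case True
  let ?w = "unit_ball_vol (real DIM('a))"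
  have "measure cone_measure (ball x r) \<le> measure lborel (ball (0::'a) 1)"
    unfolding measure_cone_measure[OF borel_open[OF open_ball]]
    using emeasure_cone_measure(2)[of "ball x r"] emeasure_lborel_ball_finite[of "0::'a" 1]
    by (intro measure_mono_fmeasurable) (auto simp: fmeasurable_def)
  also have "\<dots> = ?w * (1 * 1)" by (simp add: content_ball)
  also have "\<dots> \<le> ?w * (2 ^ (n + 2) * r ^ n)"
    using True by (intro mult_left_mono mult_mono one_le_power) auto
  finally show ?thesis by (simp only: mult.assoc)
next
  case False
  let ?w = "unit_ball_vol (real DIM('a))"
  define J where "J = nat \<lfloor>1 / r\<rfloor>"
  have J: "real J \<le> 1 / r" using r by (simp add: J_def)
  let ?S = "{y \<in> ball 0 1 - {0}. y /\<^sub>R norm y \<in> ball x r}"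
  have "?S \<subseteq> (\<Union>j\<le>J. ball ((real j * r) *\<^sub>R x) (2 * r))"
  proof
    fix y assume y: "y \<in> ?S"
    define j where "j = nat \<lfloor>norm y / r\<rfloor>"
    have "norm y / r \<ge> 0" using r by simp
    then have j: "real j \<le> norm y / r" "norm y / r < real j + 1"
      by (simp_all add: j_def)
    have "norm y / r \<le> 1 / r" using y r by (intro divide_right_mono) auto
    then have "j \<le> J" unfolding j_def J_def by (intro nat_mono floor_mono)
    have j': "real j * r \<le> norm y" "norm y < real j * r + r"
      using j r by (simp_all add: field_simps)
    have "norm (y - norm y *\<^sub>R x) = norm y * norm (y /\<^sub>R norm y - x)"
    proof -
      have "y - norm y *\<^sub>R x = norm y *\<^sub>R (y /\<^sub>R norm y - x)"
        using y by (simp add: scaleR_diff_right)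
      then show ?thesis by simp
    qed
    also have "\<dots> \<le> 1 * r"
      using y by (intro mult_mono) (auto simp: dist_norm norm_minus_commute)
    finally have 1: "norm (y - norm y *\<^sub>R x) \<le> r" by simp
    have "norm (norm y *\<^sub>R x - (real j * r) *\<^sub>R x) = \<bar>norm y - real j * r\<bar>"
      using x by (simp flip: scaleR_diff_left)
    also have "\<dots> < r" using j' by simp
    finally have "norm (y - (real j * r) *\<^sub>R x) < 2 * r"
      using 1 norm_triangle_ineq[of "y - norm y *\<^sub>R x" "norm y *\<^sub>R x - (real j * r) *\<^sub>R x"] by simp
    then show "y \<in> (\<Union>j\<le>J. ball ((real j * r) *\<^sub>R x) (2 * r))"
      using \<open>j \<le> J\<close> by (auto simp: dist_norm norm_minus_commute)
  qed
  then have "measure lborel ?S \<le> measure lborel (\<Union>j\<le>J. ball ((real j * r) *\<^sub>R x) (2 * r))"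
  proof (rule measure_mono_fmeasurable)
    have "emeasure lborel (\<Union>j\<le>J. ball ((real j * r) *\<^sub>R x) (2 * r)) < \<infinity>"
      by (intro emeasure_bounded_finite bounded_UN) auto
    then show "(\<Union>j\<le>J. ball ((real j * r) *\<^sub>R x) (2 * r)) \<in> fmeasurable lborel"
      by (simp add: fmeasurable_def)
  qed (use emeasure_cone_measure(2)[of "ball x r"] in auto)
  also have "\<dots> \<le> (\<Sum>j\<le>J. measure lborel (ball ((real j * r) *\<^sub>R x) (2 * r)))"
    by (intro measure_UNION_le) auto
  also have "\<dots> = (real J + 1) * (?w * (2 * r) ^ (n + 1))"
    using r by (simp add: content_ball dim add.commute)
  also have "\<dots> \<le> (2 / r) * (?w * (2 * r) ^ (n + 1))"
  proof (rule mult_right_mono)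
    have "1 \<le> 1 / r" using False r by simp
    with J show "real J + 1 \<le> 2 / r" by simp
  qed (use r in auto)
  also have "\<dots> = ?w * 2 ^ (n + 2) * r ^ n" using r by (simp add: power_mult_distrib)
  finally show ?thesis by (simp add: measure_cone_measure)
qed

text \<open>About \<open>1 / r\<close> disjoint balls of radius \<open>r / 8\<close>, centred on the
  segment from 0 to \<open>x\<close> at distances between 1/2 and 3/4 from 0, lie in the cone over
  the cap.\<close>

lemma cone_measure_ball_lower:
  fixes x :: "'a::euclidean_space"
  assumes x: "norm x = 1" and r: "r > 0" "r \<le> 1" and dim: "DIM('a) = n + 1"
  shows "unit_ball_vol (real DIM('a)) / 8 ^ (n + 1) * r ^ n \<le> measure cone_measure (ball x r)"
proof -
  let ?w = "unit_ball_vol (real DIM('a))"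
  define J where "J = nat \<lfloor>1 / r\<rfloor>"
  have "1 / r \<ge> 0" using r by simp
  then have J: "real J \<le> 1 / r" "1 / r \<le> real J + 1" by (simp_all add: J_def)
  define t where "t j = 1 / 2 + real j * r / 4" for j
  have t: "1 / 2 \<le> t j" "t j \<le> 3 / 4" if "j \<le> J" for j
  proof -
    have "real j * r \<le> 1" using J(1) that r by (simp add: field_simps) (smt (verit) mult_left_mono of_nat_mono)
    then show "t j \<le> 3 / 4" by (simp add: t_def)
    show "1 / 2 \<le> t j" using r by (simp add: t_def)
  qed
  let ?S = "{y \<in> ball 0 1 - {0}. y /\<^sub>R norm y \<in> ball x r}"
  have disj: "disjoint_family_on (\<lambda>j. ball (t j *\<^sub>R x) (r / 8)) {..J}"
    unfolding disjoint_family_on_def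
  proof (intro ballI impI)
    fix i j :: nat assume "i \<noteq> j"
    have "1 \<le> \<bar>real i - real j\<bar>" using \<open>i \<noteq> j\<close> by linarith
    then have "1 * (r / 4) \<le> \<bar>real i - real j\<bar> * (r / 4)" using r by (intro mult_right_mono) auto
    also have "\<dots> = \<bar>(real i - real j) * (r / 4)\<bar>" using r by (simp add: abs_mult)
    also have "(real i - real j) * (r / 4) = t i - t j" by (simp add: t_def field_simps)
    also have "\<bar>t i - t j\<bar> = dist (t i *\<^sub>R x) (t j *\<^sub>R x)"
      using x by (simp add: dist_norm flip: scaleR_diff_left)
    finally show "ball (t i *\<^sub>R x) (r / 8) \<inter> ball (t j *\<^sub>R x) (r / 8) = {}"
      by (intro disjoint_ballI) simp
  qed
  have sub: "(\<Union>j\<le>J. ball (t j *\<^sub>R x) (r / 8)) \<subseteq> ?S"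
  proof
    fix y assume "y \<in> (\<Union>j\<le>J. ball (t j *\<^sub>R x) (r / 8))"
    then obtain j where j: "j \<le> J" "norm (y - t j *\<^sub>R x) < r / 8"
      by (auto simp: dist_norm norm_minus_commute)
    have ny: "\<bar>norm y - t j\<bar> \<le> norm (y - t j *\<^sub>R x)"
      using norm_triangle_ineq3[of y "t j *\<^sub>R x"] x t[OF j(1)] by simp
    with j t[OF j(1)] r have y: "norm y < 1" "norm y > 1 / 3" by linarith+
    have "norm (t j *\<^sub>R x - norm y *\<^sub>R x) = \<bar>norm y - t j\<bar>"
      using x by (simp add: abs_minus_commute flip: scaleR_diff_left)
    then have "norm (y - norm y *\<^sub>R x) < r / 4"
      using ny j(2) norm_triangle_ineq[of "y - t j *\<^sub>R x" "t j *\<^sub>R x - norm y *\<^sub>R x"] by simp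
    moreover have "y - norm y *\<^sub>R x = norm y *\<^sub>R (y /\<^sub>R norm y - x)"
    proof -
      have "y \<noteq> 0" using y by auto
      then show ?thesis by (simp add: scaleR_diff_right)
    qed
    ultimately have "norm y * norm (y /\<^sub>R norm y - x) < r / 4" by simp
    \<comment> \<open>Normalization loses at most a factor 3, and 3/4 of \<open>r\<close> is still
      less than \<open>r\<close>.\<close>
    moreover have "1 / 3 * norm (y /\<^sub>R norm y - x) \<le> norm y * norm (y /\<^sub>R norm y - x)"
      using y by (intro mult_right_mono) auto
    ultimately have "norm (y /\<^sub>R norm y - x) < r" using r by linarith
    then show "y \<in> ?S" using y by (auto simp: dist_norm norm_minus_commute)
  qed
  have "?w / 8 ^ (n + 1) * r ^ n = 1 / r * (?w * (r / 8) ^ (n + 1))"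
    using r by (simp add: power_divide)
  also have "\<dots> \<le> (real J + 1) * (?w * (r / 8) ^ (n + 1))"
    using r J(2) by (intro mult_right_mono) auto
  also have "\<dots> = (\<Sum>j\<le>J. measure lborel (ball (t j *\<^sub>R x) (r / 8)))"
    using r by (simp add: content_ball dim add.commute)
  also have "\<dots> = measure lborel (\<Union>j\<le>J. ball (t j *\<^sub>R x) (r / 8))"
    using disj emeasure_lborel_ball_finite
    by (intro measure_finite_Union[symmetric]) (auto simp: less_top)
  also have "\<dots> \<le> measure lborel ?S"
  proof (rule measure_mono_fmeasurable[OF sub])
    have "emeasure lborel ?S \<le> emeasure lborel (ball (0::'a) 1)" by (intro emeasure_mono) auto
    then show "?S \<in> fmeasurable lborel"
      using emeasure_cone_measure(2)[of "ball x r"] emeasure_lborel_ball_finite[of "0::'a" 1]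
      unfolding fmeasurable_def by (auto intro: le_less_trans)
  qed auto
  finally show ?thesis by (simp add: measure_cone_measure)
qed

section \<open>Rational points on the sphere\<close>

definition rational_points :: "nat \<Rightarrow> (real ^ 'd::finite) set" where
  "rational_points k = {x. norm x = 1 \<and> (\<exists>p q. 1 \<le> q \<and> q \<le> 4 ^ k \<and> x = rat_point p q)}"

text \<open>For unit vectors \<open>x = p/q\<close> and \<open>y = p'/q'\<close> the number \<open>(dist x y)\<^sup>2 / 2 = (q q' - p \<bullet> p') / (q q')\<close> is a
  fraction with a positive integer numerator.\<close>
lemma rational_points_separated:
  assumes "x \<in> rational_points k" "y \<in> rational_points k" "x \<noteq> y"
  shows "1 / 4 ^ k \<le> dist x y"
proof -
  obtain p q p' q' where x: "norm x = 1" "1 \<le> q" "q \<le> 4 ^ k" "x = rat_point p q"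
    and y: "norm y = 1" "1 \<le> q'" "q' \<le> 4 ^ k" "y = rat_point p' q'"
    using assms(1,2) by (auto simp: rational_points_def)
  define m where "m = int q * int q' - (\<Sum>i\<in>UNIV. p $ i * p' $ i)"
  have qq: "real q * real q' > 0" using x y by simp
  have "x \<bullet> y = (\<Sum>i\<in>UNIV. real_of_int (p $ i * p' $ i)) / (real q * real q')"
    by (simp add: x(4) y(4) rat_point_def inner_vec_def sum_divide_distrib)
  then have "1 - x \<bullet> y = real_of_int m / (real q * real q')"
    using x(2) y(2) by (simp add: m_def diff_divide_distrib)
  moreover have "(dist x y)\<^sup>2 = x \<bullet> x - 2 * (x \<bullet> y) + y \<bullet> y"
    unfolding dist_norm power2_norm_eq_inner by (simp add: inner_diff_left inner_diff_right inner_commute[of y x])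
  then have "(dist x y)\<^sup>2 = 2 * (1 - x \<bullet> y)"
    using x(1) y(1) by (simp add: dot_square_norm)
  ultimately have d: "(dist x y)\<^sup>2 = 2 * real_of_int m / (real q * real q')" by simp
  have "(dist x y)\<^sup>2 > 0" using assms(3) by simp
  then have "real_of_int m > 0" unfolding d using qq by (simp add: zero_less_divide_iff)
  then have "m \<ge> 1" by simp
  then have m: "real_of_int m \<ge> 1" by simp
  have "real q * real q' \<le> 4 ^ k * 4 ^ k"
    using of_nat_mono[OF x(3), where 'a = real] of_nat_mono[OF y(3), where 'a = real] by (intro mult_mono) auto
  then have "1 / (4 ^ k * 4 ^ k) \<le> 1 / (real q * real q')"
    using qq by (intro divide_left_mono) auto
  also have "\<dots> \<le> (dist x y)\<^sup>2"
    unfolding d using m qq by (intro divide_right_mono) auto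
  finally have "(1 / 4 ^ k)\<^sup>2 \<le> (dist x y)\<^sup>2" by (simp add: power2_eq_square)
  then show ?thesis by (rule power2_le_imp_le) simp
qed

text \<open>Take \<open>T = 4 ^ j\<close> and let \<open>4 ^ i\<close> be the least power of 4 that
  is at least \<open>q\<close>. Then \<open>4 ^ i \<le> 4 * q\<close>, so the distance is at most a
  constant times \<open>2 ^ (- (i + j))\<close>, and \<open>D\<close> absorbs the constants.\<close>

lemma rational_points_dirichlet:
  "\<exists>D. \<forall>(\<alpha> :: real ^ 'd::finite) j. norm \<alpha> = 1 \<longrightarrow>
     (\<exists>i x. i \<le> j + D \<and> x \<in> rational_points i \<and> dist \<alpha> x \<le> 2 ^ D / 2 ^ (i + j))"
proof -
  obtain C :: real where C: "C \<ge> 1" "\<forall>\<alpha> :: real ^ 'd. norm \<alpha> = 1 \<longrightarrow> (\<forall>T \<ge> 1. \<exists>p q. q \<ge> 1 \<and> real q \<le> C * T \<and>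
    norm (rat_point p q :: real ^ 'd) = 1 \<and> (dist \<alpha> (rat_point p q))\<^sup>2 \<le> C / (real q * T))"
    using dirichlet_sphere by blast
  obtain D :: nat where D: "4 * C < 4 ^ D" using real_arch_pow[of 4 "4 * C"] by auto
  have "\<exists>i x. i \<le> j + D \<and> x \<in> rational_points i \<and> dist \<alpha> x \<le> 2 ^ D / 2 ^ (i + j)"
    if \<alpha>: "norm \<alpha> = 1" for \<alpha> :: "real ^ 'd" and j
  proof -
    have "(1::real) \<le> 4 ^ j" by simp
    then obtain p q where pq: "q \<ge> 1" "real q \<le> C * 4 ^ j" "norm (rat_point p q :: real ^ 'd) = 1"
        "(dist \<alpha> (rat_point p q))\<^sup>2 \<le> C / (real q * 4 ^ j)"
      using C(2) \<alpha> by blast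
    define i where "i = (LEAST i. q \<le> 4 ^ i)"
    have "real q \<le> 4 ^ (j + D)"
    proof -
      have "C * 4 ^ j \<le> 4 ^ D * 4 ^ j" using C(1) D by (intro mult_right_mono) auto
      with pq(2) have "real q \<le> 4 ^ D * 4 ^ j" by linarith
      then show ?thesis by (simp add: power_add mult.commute)
    qed
    then have "real q \<le> real (4 ^ (j + D))" by simp
    then have qD: "q \<le> 4 ^ (j + D)" by (simp only: of_nat_le_iff)
    then have i: "q \<le> 4 ^ i" "i \<le> j + D"
      unfolding i_def by (auto intro: LeastI Least_le)
    have "4 ^ i \<le> 4 * real q"
    proof (cases i)
      case 0
      then show ?thesis using pq(1) by simp
    next
      case (Suc i')
      have "\<not> q \<le> 4 ^ i'"
        using not_less_Least[of i' "\<lambda>i. q \<le> 4 ^ i"] Suc by (simp add: i_def)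
      then have "real (4 ^ i') < real q" by (simp only: of_nat_less_iff not_le)
      then show ?thesis by (simp add: Suc)
    qed
    then have "4 ^ i * 4 ^ j \<le> 4 * (real q * 4 ^ j)" by simp
    then have "1 / (4 * (real q * 4 ^ j)) \<le> 1 / (4 ^ i * 4 ^ j)"
      using pq(1) by (intro divide_left_mono) auto
    then have "4 * C * (1 / (4 * (real q * 4 ^ j))) \<le> 4 * C * (1 / (4 ^ i * 4 ^ j))"
      using C(1) by (intro mult_left_mono) auto
    also have "4 * C * (1 / (4 ^ i * 4 ^ j)) \<le> 4 ^ D * (1 / (4 ^ i * 4 ^ j))"
      using D by (intro mult_right_mono) auto
    finally have "(dist \<alpha> (rat_point p q))\<^sup>2 \<le> 4 ^ D / (4 ^ i * 4 ^ j)"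
      using pq(4) by simp
    also have "\<dots> = (2 ^ D / 2 ^ (i + j))\<^sup>2"
    proof -
      have "(4 :: real) ^ k = (2 ^ k)\<^sup>2" for k
        by (simp add: power2_eq_square flip: power_mult_distrib)
      then show ?thesis by (simp add: power_divide power_add power_mult_distrib)
    qed
    finally have "dist \<alpha> (rat_point p q) \<le> 2 ^ D / 2 ^ (i + j)"
      by (rule power2_le_imp_le) simp
    moreover have "rat_point p q \<in> rational_points i"
      using pq i by (auto simp: rational_points_def)
    ultimately show ?thesis using i(2) by blast
  qed
  then show ?thesis by blast
qed

lemma rational_system_sphere:
  assumes "n \<ge> 1" and dim: "CARD('d::finite) = n + 1"
  shows "\<exists>D c C. rational_system (cone_measure :: (real ^ 'd) measure) (sphere 0 1) n D c C rational_points"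
proof -
  obtain D where D: "\<forall>(\<alpha> :: real ^ 'd) j. norm \<alpha> = 1 \<longrightarrow>
     (\<exists>i x. i \<le> j + D \<and> x \<in> rational_points i \<and> dist \<alpha> x \<le> 2 ^ D / 2 ^ (i + j))"
    using rational_points_dirichlet by blast
  have dim': "DIM(real ^ 'd) = n + 1" using dim by simp
  let ?w = "unit_ball_vol (real DIM(real ^ 'd))"
  interpret finite_measure "cone_measure :: (real ^ 'd) measure" by (rule finite_measure_cone_measure)
  have empty: "{y \<in> ball 0 1 - {0}. y /\<^sub>R norm y \<in> - sphere (0 :: real ^ 'd) 1} = {}"
    by (auto, metis left_inverse norm_eq_zero)
  have "rational_system (cone_measure :: (real ^ 'd) measure) (sphere 0 1) n D (?w / 8 ^ (n + 1)) (?w * 2 ^ (n + 2)) rational_points"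
  proof
    show "emeasure (cone_measure :: (real ^ 'd) measure) (space cone_measure) \<noteq> \<infinity>" by simp
    show "?w / 8 ^ (n + 1) * r ^ n \<le> measure cone_measure (ball x r)" if "x \<in> sphere 0 1" "0 < r" "r \<le> 1"
      for x :: "real ^ 'd" and r
      using that by (intro cone_measure_ball_lower dim') auto
    show "measure cone_measure (ball x r) \<le> ?w * 2 ^ (n + 2) * r ^ n" if "x \<in> sphere 0 1" "0 < r"
      for x :: "real ^ 'd" and r
      using that by (intro cone_measure_ball_upper dim') auto
    show "measure cone_measure (- sphere (0 :: real ^ 'd) 1) = 0"
      using measure_cone_measure[of "- sphere (0 :: real ^ 'd) 1"] unfolding empty by simp
    show "rational_points k \<subseteq> sphere (0 :: real ^ 'd) 1" for k
      by (auto simp: rational_points_def)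
    show "(rational_points k :: (real ^ 'd) set) \<subseteq> rational_points l" if "k \<le> l" for k l
    proof -
      have "(4::nat) ^ k \<le> 4 ^ l" using that by (intro power_increasing) auto
      then show ?thesis unfolding rational_points_def by (blast intro: order_trans)
    qed
    show "1 / 4 ^ k \<le> dist x y" if "x \<in> rational_points k" "y \<in> rational_points k" "x \<noteq> y"
      for x y :: "real ^ 'd" and k
      using that by (rule rational_points_separated)
    show "\<exists>i x. i \<le> j + D \<and> x \<in> rational_points i \<and> dist \<alpha> x \<le> 2 ^ D / 2 ^ (i + j)"
      if "\<alpha> \<in> sphere 0 1" for \<alpha> :: "real ^ 'd" and j
      using D that by simp
  qed (use assms in auto)
  then show ?thesis by blast
qed

section \<open>Condensation of the series along the powers of 4\<close>

lemma summable_even_index_iff: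
  fixes u :: "nat \<Rightarrow> real"
  assumes dec: "decseq u" and nonneg: "\<And>k. u k \<ge> 0"
  shows "summable (\<lambda>k. u (2 * k)) \<longleftrightarrow> summable u"
proof
  assume sm: "summable (\<lambda>k. u (2 * k))"
  have "summable (\<lambda>k. u (2 * k) + u (2 * k + 1))"
  proof (rule summable_comparison_test'[OF summable_mult[OF sm, of 2]])
    fix k
    have "u (2 * k + 1) \<le> u (2 * k)" using dec by (simp add: decseq_def)
    then show "norm (u (2 * k) + u (2 * k + 1)) \<le> 2 * u (2 * k)" using nonneg by simp
  qed
  moreover have "(\<Sum>i<k. u (2 * i) + u (2 * i + 1)) = (\<Sum>i<2 * k. u i)" for k
    by (induction k) auto
  ultimately have bound: "(\<Sum>i<2 * k. u i) \<le> (\<Sum>i. u (2 * i) + u (2 * i + 1))" for k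
    using sum_le_suminf[of "\<lambda>i. u (2 * i) + u (2 * i + 1)" "{..<k}"] nonneg by simp
  show "summable u"
  proof (rule summableI_nonneg_bounded[OF nonneg])
    fix k
    have "(\<Sum>i<k. u i) \<le> (\<Sum>i<2 * k. u i)" by (rule sum_mono2) (auto simp: nonneg)
    then show "(\<Sum>i<k. u i) \<le> (\<Sum>i. u (2 * i) + u (2 * i + 1))" using bound[of k] by linarith
  qed
next
  assume "summable u"
  then have "summable (u \<circ> (\<lambda>k. 2 * k))"
    by (rule summable_reindex) (auto simp: inj_def nonneg)
  then show "summable (\<lambda>k. u (2 * k))" by (simp add: o_def)
qed

text \<open>Cauchy condensation leads to the powers of 2; as the resulting sequence is
  non-increasing, every second term decides convergence.\<close>

lemma condensation_base_4:
  fixes g :: "nat \<Rightarrow> real"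
  assumes pos: "\<And>k. k \<ge> 1 \<Longrightarrow> g k > 0" and dec: "\<And>j k. 1 \<le> j \<Longrightarrow> j \<le> k \<Longrightarrow> g k \<le> g j"
  shows "summable (\<lambda>k. g (Suc k) / real (Suc k)) \<longleftrightarrow> summable (\<lambda>k. g (4 ^ k))"
proof -
  \<comment> \<open>The value at 0 is a default that keeps \<open>f\<close> non-negative and does
    not affect summability.\<close>
  define f where "f k = (if k = 0 then 0 else g k / real k)" for k
  have "summable (\<lambda>k. g (Suc k) / real (Suc k)) \<longleftrightarrow> summable (\<lambda>k. f (Suc k))"
    by (simp add: f_def)
  also have "\<dots> \<longleftrightarrow> summable f" by (rule summable_Suc_iff)
  also have "\<dots> \<longleftrightarrow> summable (\<lambda>k. 2 ^ k * f (2 ^ k))"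
  proof (rule condensation_test)
    show "f (Suc m) \<le> f m" if "0 < m" for m
      using that dec[of m "Suc m"] pos[of m] by (auto simp: f_def intro!: frac_le)
    show "f m \<ge> 0" for m using pos[of m] by (auto simp: f_def less_imp_le)
  qed
  also have "(\<lambda>k. 2 ^ k * f (2 ^ k)) = (\<lambda>k. g (2 ^ k))" by (simp add: f_def)
  also have "summable (\<lambda>k. g (2 ^ k)) \<longleftrightarrow> summable (\<lambda>k. g (2 ^ (2 * k)))"
  proof (rule summable_even_index_iff[symmetric])
    show "decseq (\<lambda>k. g (2 ^ k))" by (auto simp: decseq_def intro!: dec power_increasing)
    show "g (2 ^ k) \<ge> 0" for k using pos[of "2 ^ k"] by (simp add: less_imp_le)
  qed
  also have "(\<lambda>k. g (2 ^ (2 * k))) = (\<lambda>k. g (4 ^ k))" by (simp add: power_mult)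
  finally show ?thesis .
qed

section \<open>The two halves for the sphere\<close>

lemma finite_rat_points_on_sphere: "finite {p. norm (rat_point p q :: real ^ 'd::finite) = 1}" if "q \<ge> 1"
proof -
  have "\<bar>p $ i\<bar> \<le> int q" if "norm (rat_point p q :: real ^ 'd) = 1" for p :: "int ^ 'd" and i
  proof -
    have "\<bar>rat_point p q $ i :: real\<bar> \<le> 1"
      using component_le_norm_cart[of "rat_point p q :: real ^ 'd" i] that by simp
    then have "real_of_int \<bar>p $ i\<bar> \<le> real_of_int (int q)" using \<open>q \<ge> 1\<close> by (simp add: rat_point_def divide_le_eq)
    then show ?thesis by (simp only: of_int_le_iff)
  qed
  then have "{p. norm (rat_point p q :: real ^ 'd) = 1} \<subseteq> vec_lambda ` (Pi\<^sub>E UNIV (\<lambda>_. {- int q..int q}))"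
    by (auto intro!: image_eqI[of _ _ "vec_nth _"] simp: abs_le_iff minus_le_iff)
  then show ?thesis by (rule finite_subset) (intro finite_imageI finite_PiE; simp)
qed

lemma antimono_of_mult_antimono:
  fixes \<phi> :: "nat \<Rightarrow> real"
  assumes pos: "\<And>k. k \<ge> 1 \<Longrightarrow> \<phi> k > 0"
    and dec: "\<And>j k. 1 \<le> j \<Longrightarrow> j \<le> k \<Longrightarrow> real k * \<phi> k \<le> real j * \<phi> j"
    and jk: "1 \<le> j" "j \<le> k"
  shows "\<phi> k \<le> \<phi> j"
proof -
  have "real k * \<phi> k \<le> real j * \<phi> j" using dec jk by blast
  also have "\<dots> \<le> real k * \<phi> j" using jk pos[of j] by (intro mult_right_mono) auto
  finally show ?thesis using jk by simp
qed

text \<open>Truncating \<phi> at half the separation makes the balls of one level disjoint and keeps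
  the series divergent. A point \<open>p/q\<close> of level \<open>k\<close> has
  \<open>q \<le> 4 ^ k\<close>, hence \<open>\<phi> (4 ^ k) \<le> \<phi> q\<close>.\<close>

lemma approximable_full:
  fixes \<phi> :: "nat \<Rightarrow> real"
  assumes n: "n \<ge> 1" and dim: "CARD('d::finite) = n + 1" and pos: "\<And>k. k \<ge> 1 \<Longrightarrow> \<phi> k > 0"
    and dec: "\<And>j k. 1 \<le> j \<Longrightarrow> j \<le> k \<Longrightarrow> real k * \<phi> k \<le> real j * \<phi> j"
    and div: "\<not> summable (\<lambda>k. (4 ^ k * \<phi> (4 ^ k)) ^ n)"
  shows "sphere 0 1 - approximable \<phi> (sphere (0 :: real ^ 'd) 1) \<in> null_sets sphere_surface"
proof -
  obtain D c C where sys: "rational_system (cone_measure :: (real ^ 'd) measure) (sphere 0 1) n D c C rational_points"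
    using rational_system_sphere[OF n dim] by blast
  interpret rational_system "cone_measure :: (real ^ 'd) measure" "sphere 0 1" n D c C rational_points
    by (rule sys)
  have \<phi>_dec: "\<phi> k \<le> \<phi> j" if "1 \<le> j" "j \<le> k" for j k
    using antimono_of_mult_antimono[of \<phi>, OF pos dec] that by blast
  define \<psi> where "\<psi> k = min (\<phi> (4 ^ k)) (1 / (2 * 4 ^ k))" for k
  have \<psi>: "4 ^ k * \<psi> k = min (4 ^ k * \<phi> (4 ^ k)) (1 / 2)" for k
    by (simp add: \<psi>_def min_mult_distrib_left)
  have "4 ^ l * \<phi> (4 ^ l) \<le> 4 ^ k * \<phi> (4 ^ k)" if "k \<le> l" for k l
    using dec[of "4 ^ k" "4 ^ l"] power_increasing[OF that, of "4 :: nat"] by simp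
  then have \<psi>_dec: "decseq (\<lambda>k. 4 ^ k * \<psi> k)"
    unfolding \<psi> decseq_def by (auto simp: min_le_iff_disj)
  have \<psi>_div: "\<not> summable (\<lambda>k. (4 ^ k * \<psi> k) ^ n)"
  proof
    assume sm: "summable (\<lambda>k. (4 ^ k * \<psi> k) ^ n)"
    \<comment> \<open>If the truncated series converged, its terms would tend to 0; the truncation
      would eventually be inactive and the original series would converge too.\<close>
    then have "(\<lambda>k. (4 ^ k * \<psi> k) ^ n) \<longlonglongrightarrow> 0" by (rule summable_LIMSEQ_zero)
    then have "\<forall>\<^sub>F k in sequentially. (4 ^ k * \<psi> k) ^ n < (1 / 2) ^ n" by (intro order_tendstoD) auto
    then have "\<forall>\<^sub>F k in sequentially. norm ((4 ^ k * \<phi> (4 ^ k)) ^ n) \<le> (4 ^ k * \<psi> k) ^ n"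
    proof eventually_elim
      case (elim k)
      have "min (4 ^ k * \<phi> (4 ^ k)) (1 / 2) \<noteq> 1 / 2" using elim by (metis \<psi> less_irrefl)
      then have "4 ^ k * \<psi> k = 4 ^ k * \<phi> (4 ^ k)" unfolding \<psi> by (auto simp: min_def split: if_splits)
      moreover have "\<phi> (4 ^ k) > 0" by (intro pos) simp
      ultimately show ?case by simp
    qed
    then have "summable (\<lambda>k. (4 ^ k * \<phi> (4 ^ k)) ^ n)"
      using sm by (rule summable_comparison_test_ev)
    with div show False by simp
  qed
  have \<psi>_pos: "\<psi> k > 0" for k using pos[of "4 ^ k"] by (simp add: \<psi>_def)
  have \<psi>_small: "4 ^ k * \<psi> k \<le> 1 / 2" for k unfolding \<psi> by simp
  obtain K where K: "measure cone_measure
      (- (\<Inter>m. \<Union>k\<in>{m..}. \<Union>x\<in>rational_points k - rational_points (k - K). ball x (\<psi> k)) :: (real ^ 'd) set) = 0"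
    using full_limsup[OF \<psi>_pos \<psi>_dec \<psi>_small \<psi>_div] by blast
  define W where "W = (\<Inter>m. \<Union>k\<in>{m..}. \<Union>x\<in>rational_points k - rational_points (k - K). ball (x :: real ^ 'd) (\<psi> k))"
  have "\<alpha> \<in> approximable \<phi> (sphere 0 1)" if \<alpha>: "\<alpha> \<in> sphere 0 1" "\<alpha> \<in> W" for \<alpha> :: "real ^ 'd"
    unfolding approximable_def
  proof (intro CollectI conjI)
    let ?A = "{(p, q). 1 \<le> q \<and> rat_point p q \<in> sphere 0 1 \<and> infnorm (\<alpha> - rat_point p q) < \<phi> q}"
    show "infinite ?A"
    proof
      assume "finite ?A"
      then have "finite (snd ` ?A)" by (rule finite_imageI)
      then obtain B where B: "\<forall>q\<in>snd ` ?A. q \<le> B"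
        unfolding finite_nat_set_iff_bounded_le by (rule exE)
      \<comment> \<open>If the denominators were bounded by \<open>B\<close>, a point outside
        \<open>rational_points (k - K)\<close> with \<open>k - K \<ge> B\<close> would contradict
        this, its denominators being above \<open>4 ^ B\<close>.\<close>
      have B4: "B < 4 ^ B" by (rule power_gt_expt) simp
      obtain k x where k: "k \<ge> B + K" and x: "x \<in> rational_points k" "x \<notin> rational_points (k - K)" "dist x \<alpha> < \<psi> k"
      proof -
        have "\<alpha> \<in> (\<Union>k\<in>{B + K..}. \<Union>x\<in>rational_points k - rational_points (k - K). ball x (\<psi> k))"
          using \<alpha>(2) unfolding W_def by (rule INT_D[OF _ UNIV_I])
        then show ?thesis using that by auto
      qed
      obtain p q where pq: "norm x = 1" "1 \<le> q" "q \<le> 4 ^ k" "x = rat_point p q"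
        using x(1) by (auto simp: rational_points_def)
      have "infnorm (\<alpha> - rat_point p q) \<le> norm (\<alpha> - rat_point p q)" by (rule infnorm_le_norm)
      also have "\<dots> < \<psi> k" using x(3) by (simp add: dist_norm norm_minus_commute pq(4))
      also have "\<psi> k \<le> \<phi> (4 ^ k)" by (simp add: \<psi>_def)
      also have "\<dots> \<le> \<phi> q" using \<phi>_dec pq by auto
      finally have "(p, q) \<in> ?A" using pq by auto
      then have "snd (p, q) \<in> snd ` ?A" by (rule imageI)
      from B[rule_format, OF this] have "q \<le> B" by (simp only: snd_conv)
      moreover have "\<not> q \<le> 4 ^ (k - K)" using x(2) pq by (auto simp: rational_points_def)
      moreover have "(4::nat) ^ B \<le> 4 ^ (k - K)" using k by (intro power_increasing) auto
      ultimately show False using B4 by linarith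
    qed
  qed (use \<alpha> in auto)
  then have "sphere 0 1 - approximable \<phi> (sphere 0 1) \<subseteq> - W" by blast
  moreover have "- W \<in> sets borel" unfolding W_def by (intro borel_comp sets.countable_INT'' borel_open) auto
  ultimately show ?thesis using K unfolding W_def[symmetric] by (intro null_sets_sphere_surface) auto
qed

text \<open>Each denominator admits only finitely many points on the sphere, so an approximable
  point has approximations with arbitrarily large \<open>q\<close>. With
  \<open>4 ^ k \<le> q < 4 ^ (k + 1)\<close> the point \<open>p/q\<close> is of level
  \<open>k + 1\<close>, and \<open>\<phi> q \<le> \<phi> (4 ^ k)\<close>.\<close>

lemma approximable_null:
  fixes \<phi> :: "nat \<Rightarrow> real"
  assumes n: "n \<ge> 1" and dim: "CARD('d::finite) = n + 1" and pos: "\<And>k. k \<ge> 1 \<Longrightarrow> \<phi> k > 0"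
    and dec: "\<And>j k. 1 \<le> j \<Longrightarrow> j \<le> k \<Longrightarrow> real k * \<phi> k \<le> real j * \<phi> j"
    and conv: "summable (\<lambda>k. (4 ^ k * \<phi> (4 ^ k)) ^ n)"
  shows "approximable \<phi> (sphere (0 :: real ^ 'd) 1) \<in> null_sets sphere_surface"
proof -
  obtain D c C where sys: "rational_system (cone_measure :: (real ^ 'd) measure) (sphere 0 1) n D c C rational_points"
    using rational_system_sphere[OF n dim] by blast
  interpret rational_system "cone_measure :: (real ^ 'd) measure" "sphere 0 1" n D c C rational_points
    by (rule sys)
  have \<phi>_dec: "\<phi> k \<le> \<phi> j" if "1 \<le> j" "j \<le> k" for j k
    using antimono_of_mult_antimono[of \<phi>, OF pos dec] that by blast
  let ?s = "sqrt (real DIM(real ^ 'd))"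
  have s: "?s > 0" by simp
  \<comment> \<open>The index is shifted because \<open>4 ^ k \<le> q < 4 ^ (k + 1)\<close> puts
    \<open>p/q\<close> into level \<open>k + 1\<close>; at 0 the truncated subtraction gives
    \<open>\<phi> 1\<close>. The factor \<open>?s\<close> passes from the supremum norm to the
    Euclidean norm.\<close>
  define r where "r k = ?s * \<phi> (4 ^ (k - 1))" for k
  have r: "r k > 0" for k unfolding r_def using s pos[of "4 ^ (k - 1)"] by (intro mult_pos_pos) auto
  have "summable (\<lambda>k. (4 * ?s) ^ n * (4 ^ k * \<phi> (4 ^ k)) ^ n)" using conv by (rule summable_mult)
  moreover have "(4 * ?s) ^ n * (4 ^ k * \<phi> (4 ^ k)) ^ n = (4 ^ Suc k * r (Suc k)) ^ n" for k
  proof -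
    have "4 * ?s * (4 ^ k * \<phi> (4 ^ k)) = 4 ^ Suc k * r (Suc k)" by (simp add: r_def)
    then show ?thesis by (simp only: power_mult_distrib[symmetric])
  qed
  ultimately have "summable (\<lambda>k. (4 ^ Suc k * r (Suc k)) ^ n)" by (simp only:)
  then have "summable (\<lambda>k. (4 ^ k * r k) ^ n)" by (rule summable_Suc_iff[THEN iffD1])
  then have null: "limsup (\<lambda>k. \<Union>x\<in>rational_points k. ball x (r k)) \<in> null_sets (cone_measure :: (real ^ 'd) measure)"
    by (intro null_limsup r)
  have "\<alpha> \<in> limsup (\<lambda>k. \<Union>x\<in>rational_points k. ball x (r k))"
    if \<alpha>: "\<alpha> \<in> approximable \<phi> (sphere 0 1)" for \<alpha> :: "real ^ 'd"
    unfolding mem_limsup_iff frequently_sequentially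
  proof
    fix m :: nat
    let ?A = "{(p, q). 1 \<le> q \<and> rat_point p q \<in> sphere 0 1 \<and> infnorm (\<alpha> - rat_point p q) < \<phi> q}"
    have "infinite ?A" using \<alpha> by (simp add: approximable_def)
    have "\<exists>p q. (p, q) \<in> ?A \<and> 4 ^ m \<le> q"
    proof (rule ccontr)
      assume "\<not> ?thesis"
      then have less: "\<And>p q. (p, q) \<in> ?A \<Longrightarrow> q < 4 ^ m" by (meson not_le)
      have "?A \<subseteq> (\<Union>q\<in>{1..<4 ^ m}. {p. norm (rat_point p q :: real ^ 'd) = 1} \<times> {q})"
      proof
        fix z assume z: "z \<in> ?A"
        obtain p q where pq: "z = (p, q)" by (cases z)
        with z less show "z \<in> (\<Union>q\<in>{1..<4 ^ m}. {p. norm (rat_point p q :: real ^ 'd) = 1} \<times> {q})"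
          by auto
      qed
      moreover have "finite (\<Union>q\<in>{1..<4 ^ m}. {p. norm (rat_point p q :: real ^ 'd) = 1} \<times> {q})"
        by (intro finite_UN_I finite_cartesian_product finite_rat_points_on_sphere) auto
      ultimately have "finite ?A" by (rule finite_subset)
      with \<open>infinite ?A\<close> show False by simp
    qed
    then obtain p q where pq: "1 \<le> q" "norm (rat_point p q :: real ^ 'd) = 1" "infnorm (\<alpha> - rat_point p q) < \<phi> q" "4 ^ m \<le> q"
      by auto
    obtain k where k: "4 ^ k \<le> q" "q < 4 ^ (k + 1)"
      using ex_power_ivl1[of 4 q] pq(1) by auto
    have "(4::nat) ^ m < 4 ^ (k + 1)" using pq(4) k(2) by linarith
    then have "m < k + 1" by (rule power_less_imp_less_exp[rotated]) simp
    have "norm (\<alpha> - rat_point p q) \<le> ?s * infnorm (\<alpha> - rat_point p q)" by (rule norm_le_infnorm)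
    also have "\<dots> < ?s * \<phi> q" using pq(3) s by (intro mult_strict_left_mono)
    also have "\<dots> \<le> ?s * \<phi> (4 ^ k)" using s k \<phi>_dec[of "4 ^ k" q] by (intro mult_left_mono) auto
    finally have "\<alpha> \<in> ball (rat_point p q) (r (k + 1))" by (simp add: r_def dist_norm norm_minus_commute)
    moreover have "rat_point p q \<in> (rational_points (k + 1) :: (real ^ 'd) set)"
      using pq k(2) by (auto simp: rational_points_def intro!: exI[of _ p] exI[of _ q])
    ultimately show "\<exists>k\<ge>m. \<alpha> \<in> (\<Union>x\<in>rational_points k. ball x (r k))"
      using \<open>m < k + 1\<close> by (intro exI[of _ "k + 1"]) auto
  qed
  then have "approximable \<phi> (sphere (0 :: real ^ 'd) 1) \<subseteq> limsup (\<lambda>k. \<Union>x\<in>rational_points k. ball x (r k))" by blast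
  moreover have "approximable \<phi> (sphere (0 :: real ^ 'd) 1) \<subseteq> sphere 0 1" by (auto simp: approximable_def)
  ultimately show ?thesis
    using null by (intro null_sets_sphere_surface[of _ "limsup (\<lambda>k. \<Union>x\<in>rational_points k. ball x (r k))"])
      (auto simp: null_sets_def measure_def)
qed

theorem theorem1p3:
  fixes \<phi> :: "nat \<Rightarrow> real" and n :: nat
  assumes "n \<ge> 1"
    and "CARD('d::finite) = n + 1"
    and "\<And>k. k \<ge> 1 \<Longrightarrow> \<phi> k > 0"
    and "\<And>j k. 1 \<le> j \<Longrightarrow> j \<le> k \<Longrightarrow> real k * \<phi> k \<le> real j * \<phi> j"
  shows "(sphere 0 1 - approximable \<phi> (sphere (0 :: real ^ 'd) 1) \<in> null_sets sphere_surface
            \<longleftrightarrow> \<not> summable (\<lambda>k. real (Suc k) ^ (n - 1) * \<phi> (Suc k) ^ n))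
       \<and> (approximable \<phi> (sphere (0 :: real ^ 'd) 1) \<in> null_sets sphere_surface
            \<longleftrightarrow> summable (\<lambda>k. real (Suc k) ^ (n - 1) * \<phi> (Suc k) ^ n))"
proof -
  let ?A = "approximable \<phi> (sphere (0 :: real ^ 'd) 1)"
  \<comment> \<open>The summand becomes a non-increasing function of the index divided by the index,
    the form required for condensation.\<close>
  have "real (Suc k) ^ (n - 1) * \<phi> (Suc k) ^ n = (real (Suc k) * \<phi> (Suc k)) ^ n / real (Suc k)" for k
    using assms(1) by (cases n) (simp_all add: power_mult_distrib)
  then have "summable (\<lambda>k. real (Suc k) ^ (n - 1) * \<phi> (Suc k) ^ n)
      \<longleftrightarrow> summable (\<lambda>k. (real (Suc k) * \<phi> (Suc k)) ^ n / real (Suc k))" by presburger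
  also have "\<dots> \<longleftrightarrow> summable (\<lambda>k. (real (4 ^ k) * \<phi> (4 ^ k)) ^ n)"
  proof (rule condensation_base_4)
    show "(real k * \<phi> k) ^ n > 0" if "k \<ge> 1" for k using that assms(3) by simp
    show "(real k * \<phi> k) ^ n \<le> (real j * \<phi> j) ^ n" if "1 \<le> j" "j \<le> k" for j k
      using assms(4)[OF that] assms(3)[of k] that by (intro power_mono) auto
  qed
  finally have sum_iff: "summable (\<lambda>k. real (Suc k) ^ (n - 1) * \<phi> (Suc k) ^ n)
      \<longleftrightarrow> summable (\<lambda>k. (4 ^ k * \<phi> (4 ^ k)) ^ n)" by simp
  \<comment> \<open>Since the sphere is not null, the two implications already yield both
    equivalences.\<close>
  have not_both: "\<not> (sphere 0 1 - ?A \<in> null_sets sphere_surface \<and> ?A \<in> null_sets sphere_surface)"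
  proof
    assume "sphere 0 1 - ?A \<in> null_sets sphere_surface \<and> ?A \<in> null_sets sphere_surface"
    then have "(sphere 0 1 - ?A) \<union> ?A \<in> null_sets sphere_surface" by (intro null_sets.Un) auto
    moreover have "(sphere 0 1 - ?A) \<union> ?A = sphere 0 1" by (auto simp: approximable_def)
    ultimately show False using sphere_not_null by metis
  qed
  show ?thesis
  proof (cases "summable (\<lambda>k. (4 ^ k * \<phi> (4 ^ k)) ^ n)")
    case True
    then have "?A \<in> null_sets sphere_surface" using approximable_null[OF assms] by blast
    with True not_both show ?thesis unfolding sum_iff by blast
  next
    case False
    then have "sphere 0 1 - ?A \<in> null_sets sphere_surface" using approximable_full[OF assms] by blast
    with False not_both show ?thesis unfolding sum_iff by blast
  qed
qed

end
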